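(* Let $\alpha,\mu$ be real numbers with $0<\mu\le 1$ and $\alpha+\mu\ge 0$, and let $\beta,\gamma,\delta$ be complex numbers with $\beta\neq 0$. Let $q\in\mathcal{R}(\alpha,\beta,\gamma,\delta,\mu)$ be analytic and univalent in $\mathbb{D}$, set $R(z):=\frac{zq'(z)}{\beta q(z)+\gamma}$ $(z\in\mathbb{D})$, and assume that $$\operatorname{Re}\left((\beta q(z)+\gamma)\left(1+\frac{\alpha}{\mu}+\frac{\alpha\delta}{\mu q(z)}\right)\right)>0\quad(z\in\mathbb{D})$$ and $$\operatorname{Re}\left(\frac{\alpha}{\mu}\frac{zq'(z)}{q(z)}+\frac{zR'(z)}{R(z)}\right)>0\quad(z\in\mathbb{D}).$$ Let $p\in\mathcal{R}(\alpha,\beta,\gamma,\delta,\mu)$ satisfy $p\in\mathcal{H}\cap\mathcal{Q}$ and let $$(p(z))^{\frac{\alpha}{\mu}+1}+\delta(p(z))^{\frac{\alpha}{\mu}}+(p(z))^{\frac{\alpha}{\mu}}\frac{zp'(z)}{\beta p(z)+\gamma}$$ be univalent in $\mathbb{D}$. If $p$ satisfies $$(q(z))^\alpha\left(q(z)+\delta+\frac{zq'(z)}{\beta q(z)+\gamma}\right)^\mu\prec(p(z))^\alpha\left(p(z)+\delta+\frac{zp'(z)}{\beta p(z)+\gamma}\right)^\mu,$$ then $q(z)\prec p(z)$, and $q$ is the best subordinant of this differential superordination.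
   Context: $\mathbb{D}=\{z\in\mathbb{C}:|z|<1\}$; $\mathcal{H}$ is the class of analytic functions in $\mathbb{D}$. Univalent means analytic and injective. For $f,g\in\mathcal{H}$, $f\prec g$ ($f$ is subordinate to $g$) means there is an analytic $w:\mathbb{D}\to\mathbb{D}$ with $w(0)=0$ and $f(z)=g(w(z))$ for all $z\in\mathbb{D}$. $\mathcal{Q}$ is the set of all functions $f$ that are analytic and injective on $\overline{\mathbb{D}}\setminus E(f)$, where $E(f)=\{\zeta\in\partial\mathbb{D}:\lim_{z\to\zeta}f(z)=\infty\}$, and are such that $f'(\zeta)\ne 0$ for $\zeta\in\partial\mathbb{D}\setminus E(f)$. The class $\mathcal{R}(\alpha,\beta,\gamma,\delta,\mu)$ consists of the analytic functions $p$ in $\mathbb{D}$ with $p(0)=1$, $p(z)\ne 0$ in $\mathbb{D}$, such that $P(z):=(p(z))^\alpha\left(p(z)+\delta+\frac{zp'(z)}{\beta p(z)+\gamma}\right)^\mu$ is well-defined in $\mathbb{D}$, the powers being principal values; that is, $\beta p(z)+\gamma$ has no zeros in $\mathbb{D}$ and the two principal powers appearing in $P$ are analytic functions in $\mathbb{D}$. The function $zR'(z)/R(z)$ is understood at $z=0$ by its removable-singularity value. A solution of the differential superordination is a univalent $p\in\mathcal{R}(\alpha,\beta,\gamma,\delta,\mu)$ satisfying it for which $(p(z))^{\frac{\alpha}{\mu}+1}+\delta(p(z))^{\frac{\alpha}{\mu}}+(p(z))^{\frac{\alpha}{\mu}}\frac{zp'(z)}{\beta p(z)+\gamma}$ is univalent.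 An analytic function $\tilde q$ is a subordinant if $\tilde q\prec p$ for every solution $p$; the best subordinant is a univalent subordinant $q$ such that $\tilde q\prec q$ for every subordinant $\tilde q$. *)

theory Defs
  imports "HOL-Complex_Analysis.Complex_Analysis"
begin

abbreviation unit_disc :: "complex set" where
  "unit_disc \<equiv> ball 0 1"

definition univalent :: "(complex \<Rightarrow> complex) \<Rightarrow> bool" where
  "univalent f \<longleftrightarrow> f holomorphic_on unit_disc \<and> inj_on f unit_disc"

definition subordinate :: "(complex \<Rightarrow> complex) \<Rightarrow> (complex \<Rightarrow> complex) \<Rightarrow> bool"
    (infix \<open>\<prec>\<^sub>s\<close> 50) where
  "f \<prec>\<^sub>s g \<longleftrightarrow> f holomorphic_on unit_disc \<and> g holomorphic_on unit_disc \<and>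
     (\<exists>w. w holomorphic_on unit_disc \<and> w ` unit_disc \<subseteq> unit_disc \<and> w 0 = 0 \<and>
          (\<forall>z\<in>unit_disc. f z = g (w z)))"

text \<open>
  The limit at a boundary point is taken from inside the disc, so the exceptional set depends
  only on the restriction of \<open>f\<close> to the disc.
\<close>
definition exceptional_set :: "(complex \<Rightarrow> complex) \<Rightarrow> complex set" where
  "exceptional_set f = {\<zeta> \<in> sphere 0 1. filterlim f at_infinity (at \<zeta> within unit_disc)}"

text \<open>
  Analyticity at a boundary point means analyticity in a full neighbourhood of it. Functions being
  total, the values of \<open>f\<close> outside the disc, near the nonexceptional boundary points, are
  those of this analytic continuation; continuations at different boundary points always agree on
  the overlap of discs centred at these points, since the overlap is connected and meets the unit
  disc.
\<close>
definition class_Q :: "(complex \<Rightarrow> complex) set" where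
  "class_Q = {f. f analytic_on (cball 0 1 - exceptional_set f) \<and>
                 inj_on f (cball 0 1 - exceptional_set f) \<and>
                 (\<forall>\<zeta> \<in> sphere 0 1 - exceptional_set f. deriv f \<zeta> \<noteq> 0)}"

definition bb_term :: "complex \<Rightarrow> complex \<Rightarrow> (complex \<Rightarrow> complex) \<Rightarrow> complex \<Rightarrow> complex" where
  "bb_term \<beta> \<gamma> p z = z * deriv p z / (\<beta> * p z + \<gamma>)"

text \<open>Complex \<open>powr\<close> is the principal power, with \<open>0 powr a = 0\<close>.\<close>
definition power_op ::
    "real \<Rightarrow> complex \<Rightarrow> complex \<Rightarrow> complex \<Rightarrow> real \<Rightarrow> (complex \<Rightarrow> complex) \<Rightarrow> complex \<Rightarrow> complex" where
  "power_op \<alpha> \<beta> \<gamma> \<delta> \<mu> p z =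
     p z powr of_real \<alpha> * (p z + \<delta> + bb_term \<beta> \<gamma> p z) powr of_real \<mu>"

definition class_R ::
    "real \<Rightarrow> complex \<Rightarrow> complex \<Rightarrow> complex \<Rightarrow> real \<Rightarrow> (complex \<Rightarrow> complex) set" where
  "class_R \<alpha> \<beta> \<gamma> \<delta> \<mu> = {p. p holomorphic_on unit_disc \<and> p 0 = 1 \<and>
     (\<forall>z\<in>unit_disc. p z \<noteq> 0) \<and>
     (\<forall>z\<in>unit_disc. \<beta> * p z + \<gamma> \<noteq> 0) \<and>
     (\<lambda>z. p z powr of_real \<alpha>) holomorphic_on unit_disc \<and>
     (\<lambda>z. (p z + \<delta> + bb_term \<beta> \<gamma> p z) powr of_real \<mu>) holomorphic_on unit_disc}"

definition sum_op ::
    "real \<Rightarrow> complex \<Rightarrow> complex \<Rightarrow> complex \<Rightarrow> real \<Rightarrow> (complex \<Rightarrow> complex) \<Rightarrow> complex \<Rightarrow> complex" where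
  "sum_op \<alpha> \<beta> \<gamma> \<delta> \<mu> p z =
     p z powr of_real (\<alpha> / \<mu> + 1) + \<delta> * p z powr of_real (\<alpha> / \<mu>)
       + p z powr of_real (\<alpha> / \<mu>) * bb_term \<beta> \<gamma> p z"

text \<open>
  In the following, \<open>h\<close> is the left-hand side of the differential superordination
  \<open>h \<prec>\<^sub>s power_op \<alpha> \<beta> \<gamma> \<delta> \<mu> p\<close> in the unknown \<open>p\<close>.
\<close>
definition superord_solution ::
    "real \<Rightarrow> complex \<Rightarrow> complex \<Rightarrow> complex \<Rightarrow> real \<Rightarrow> (complex \<Rightarrow> complex) \<Rightarrow> (complex \<Rightarrow> complex) \<Rightarrow> bool" where
  "superord_solution \<alpha> \<beta> \<gamma> \<delta> \<mu> h p \<longleftrightarrow>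
     univalent p \<and> p \<in> class_R \<alpha> \<beta> \<gamma> \<delta> \<mu> \<and> univalent (sum_op \<alpha> \<beta> \<gamma> \<delta> \<mu> p) \<and>
     h \<prec>\<^sub>s power_op \<alpha> \<beta> \<gamma> \<delta> \<mu> p"

definition subordinant ::
    "real \<Rightarrow> complex \<Rightarrow> complex \<Rightarrow> complex \<Rightarrow> real \<Rightarrow> (complex \<Rightarrow> complex) \<Rightarrow> (complex \<Rightarrow> complex) \<Rightarrow> bool" where
  "subordinant \<alpha> \<beta> \<gamma> \<delta> \<mu> h q \<longleftrightarrow>
     q holomorphic_on unit_disc \<and> (\<forall>p. superord_solution \<alpha> \<beta> \<gamma> \<delta> \<mu> h p \<longrightarrow> q \<prec>\<^sub>s p)"

definition best_subordinant ::
    "real \<Rightarrow> complex \<Rightarrow> complex \<Rightarrow> complex \<Rightarrow> real \<Rightarrow> (complex \<Rightarrow> complex) \<Rightarrow> (complex \<Rightarrow> complex) \<Rightarrow> bool" where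
  "best_subordinant \<alpha> \<beta> \<gamma> \<delta> \<mu> h q \<longleftrightarrow>
     univalent q \<and> subordinant \<alpha> \<beta> \<gamma> \<delta> \<mu> h q \<and>
     (\<forall>q'. subordinant \<alpha> \<beta> \<gamma> \<delta> \<mu> h q' \<longrightarrow> q' \<prec>\<^sub>s q)"

text \<open>
  \<open>z R'(z) / R(z)\<close>, with removable singularities filled in: at a zero of \<open>R\<close> at the origin the
  total division would otherwise give the value \<open>0\<close>.
\<close>
definition zlogderiv :: "(complex \<Rightarrow> complex) \<Rightarrow> complex \<Rightarrow> complex" where
  "zlogderiv R = remove_sings (\<lambda>z. z * deriv R z / R z)"

end

theory Submission
  imports Defs
begin

text \<open>
  Write \<open>k = \<alpha> / \<mu>\<close>, \<open>T = q\<^sup>k (q + \<delta>)\<close> and \<open>z V = q\<^sup>k R\<close>. The hypotheses say that \<open>z V\<close> is starlike and that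
  \<open>T + t z V\<close>, \<open>t > 0\<close>, is a Loewner chain. Hence \<open>h = T + z V\<close> is univalent, and \<open>T z + t z V z\<close> lies
  in the image under \<open>h\<close> of the closed disc of radius \<open>\<bar>z\<bar>\<close> whenever \<open>0 < t \<le> 1\<close>. After taking
  \<open>\<mu>\<close>-th roots the superordination becomes \<open>h \<prec> P\<close>, with \<open>P\<close> the univalent function formed from \<open>p\<close>.
  Choose \<open>r, \<rho> < 1\<close> such that \<open>P\<close> takes on \<open>\<bar>\<zeta>\<bar> < \<rho>\<close> all values of \<open>h\<close> on \<open>\<bar>z\<bar> \<le> r\<close>. If \<open>q\<close> left
  the image of \<open>\<bar>\<zeta>\<bar> < \<rho>\<close> under \<open>p\<close>, then at a first exit point \<open>z\<^sub>0\<close> Jack's lemma would give \<open>q z\<^sub>0 = p \<zeta>\<close> and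
  \<open>z\<^sub>0 q' z\<^sub>0 = m \<zeta> p' \<zeta>\<close> with \<open>\<bar>\<zeta>\<bar> = \<rho>\<close> and \<open>m \<ge> 1\<close>. Then \<open>P \<zeta> = T z\<^sub>0 + z\<^sub>0 V z\<^sub>0 / m\<close> would also be a value
  of \<open>P\<close> on \<open>\<bar>\<zeta>\<bar> < \<rho>\<close>, contradicting the univalence of \<open>P\<close>.
\<close>

subsection \<open>Analytic logarithms and principal powers\<close>

text \<open>A connected set of complex numbers with two points is uncountable. Countability is asked
  for instead of discreteness because the ratios \<open>exp (a * 2 * pi * n * i)\<close> between
  branches of a power can be dense in the unit circle.\<close>

lemma countable_range_constant:
  fixes f :: "'a::topological_space \<Rightarrow> complex"
  assumes "connected S" "continuous_on S f" "f ` S \<subseteq> C" "countable C" "x \<in> S" "y \<in> S"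
  shows "f x = f y"
proof (rule ccontr)
  assume "f x \<noteq> f y"
  then have "uncountable (f ` S)"
    using connected_uncountable[OF connected_continuous_image[OF assms(2,1)]] assms(5,6) by blast
  then show False
    using assms(3,4) countable_subset by blast
qed

text \<open>The difference of \<open>f\<close> and \<open>g\<close> takes values in the countable
  set of multiples of 2 pi i / a, so it is constant. This is how roots are extracted and how
  analytic logarithms of the same function are identified.\<close>

lemma exp_eq_imp_eq:
  fixes f g :: "'a::topological_space \<Rightarrow> complex"
  assumes "connected S" "continuous_on S f" "continuous_on S g" "a \<noteq> 0"
    and e: "\<And>x. x \<in> S \<Longrightarrow> exp (a * f x) = exp (a * g x)"
    and "x0 \<in> S" "f x0 = g x0" "x \<in> S"
  shows "f x = g x"
proof -
  let ?C = "range (\<lambda>n::int. of_int (2 * n) * pi * \<i> / a)"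
  have "(\<lambda>x. f x - g x) ` S \<subseteq> ?C"
  proof safe
    fix y assume "y \<in> S"
    then obtain n :: int where "a * f y = a * g y + (of_int (2 * n) * pi) * \<i>"
      using e[of y] unfolding exp_eq by auto
    then have "f y - g y = of_int (2 * n) * pi * \<i> / a"
      using \<open>a \<noteq> 0\<close> by (simp add: field_simps)
    then show "f y - g y \<in> ?C" by blast
  qed
  then have "f x - g x = f x0 - g x0"
    by (intro countable_range_constant[OF \<open>connected S\<close>, of "\<lambda>x. f x - g x" ?C])
       (use assms in \<open>auto intro!: continuous_intros\<close>)
  then show ?thesis using assms by simp
qed

lemma holomorphic_log_normalized:
  assumes "f holomorphic_on unit_disc" "\<And>z. z \<in> unit_disc \<Longrightarrow> f z \<noteq> 0"
  obtains g where "g holomorphic_on unit_disc" "\<And>z. z \<in> unit_disc \<Longrightarrow> exp (g z) = f z"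
    "g 0 = Ln (f 0)"
proof -
  obtain h where h: "h holomorphic_on unit_disc" "\<And>z. z \<in> unit_disc \<Longrightarrow> f z = exp (h z)"
    using contractible_imp_holomorphic_log[OF assms(1) _ assms(2)] convex_imp_contractible
      convex_ball by blast
  have f0: "f 0 = exp (h 0)" using h(2)[of 0] by simp
  show thesis
  proof (rule that[of "\<lambda>z. h z - h 0 + Ln (f 0)"])
    show "(\<lambda>z. h z - h 0 + Ln (f 0)) holomorphic_on unit_disc"
      by (intro holomorphic_intros h)
    show "exp (h z - h 0 + Ln (f 0)) = f z" if "z \<in> unit_disc" for z
      using h(2)[OF that] f0 by (simp add: exp_add exp_diff)
  qed auto
qed

text \<open>At each point \<open>Ln (f x)\<close> and \<open>g x\<close> differ by a multiple of 2
  pi i that may jump. The quotient of the two powers is nevertheless continuous, as both are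
  analytic, and has countably many values. So it equals its value 1 at the origin.\<close>

lemma holomorphic_powr_eq_exp_log:
  assumes hol: "(\<lambda>z. f z powr a) holomorphic_on unit_disc"
    and g: "g holomorphic_on unit_disc" "\<And>z. z \<in> unit_disc \<Longrightarrow> exp (g z) = f z" "g 0 = Ln (f 0)"
    and "z \<in> unit_disc"
  shows "f z powr a = exp (a * g z)"
proof -
  let ?C = "range (\<lambda>n::int. exp (a * (of_int (2 * n) * pi * \<i>)))"
  have q: "f x powr a * exp (- a * g x) = exp (a * (Ln (f x) - g x))" and nz: "f x \<noteq> 0"
    if "x \<in> unit_disc" for x
    using g(2)[OF that, symmetric] by (auto simp: powr_def exp_diff exp_minus algebra_simps divide_inverse)
  have "f z powr a * exp (- a * g z) = f 0 powr a * exp (- a * g 0)"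
  proof (rule countable_range_constant[of unit_disc "\<lambda>z. f z powr a * exp (- a * g z)" ?C z 0])
    show "continuous_on unit_disc (\<lambda>z. f z powr a * exp (- a * g z))"
      by (intro holomorphic_on_imp_continuous_on holomorphic_intros hol g)
    show "(\<lambda>z. f z powr a * exp (- a * g z)) ` unit_disc \<subseteq> ?C"
    proof safe
      fix x :: complex assume x: "x \<in> unit_disc"
      have "exp (Ln (f x)) = exp (g x)" using g(2)[OF x] nz[OF x] by simp
      then obtain n :: int where "Ln (f x) = g x + (of_int (2 * n) * pi) * \<i>"
        unfolding exp_eq by auto
      then show "f x powr a * exp (- a * g x) \<in> ?C"
        using q[OF x] by auto
    qed
  qed (use \<open>z \<in> unit_disc\<close> in auto)
  also have "\<dots> = 1" using q[of 0] g(3) by simp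
  finally show ?thesis by (simp add: exp_minus divide_simps)
qed

text \<open>
  The principal power takes no values on the negative real axis, so by the open mapping theorem
  it cannot vanish.
\<close>
lemma holomorphic_powr_nonzero:
  fixes m :: real
  assumes hol: "(\<lambda>z. f z powr of_real m) holomorphic_on unit_disc"
    and m: "0 < m" "m < 1"
    and nz: "a \<in> unit_disc" "f a \<noteq> 0" and z: "z \<in> unit_disc"
  shows "f z \<noteq> 0"
proof
  assume "f z = 0"
  let ?H = "\<lambda>z. f z powr of_real m"
  have "\<not> ?H constant_on unit_disc"
  proof
    assume "?H constant_on unit_disc"
    then have "?H a = ?H z" using nz z unfolding constant_on_def by metis
    then show False using \<open>f z = 0\<close> nz by simp
  qed
  then have "open (?H ` unit_disc)"
    by (intro open_mapping_thm[OF hol]) auto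
  \<comment> \<open>This uses the convention \<open>0 powr a = 0\<close>.\<close>
  moreover have "0 \<in> ?H ` unit_disc"
    using \<open>f z = 0\<close> z by (intro image_eqI[of _ _ z]) auto
  ultimately obtain e where e: "e > 0" "ball 0 e \<subseteq> ?H ` unit_disc"
    using openE by blast
  have "- of_real (e / 2) \<in> ball (0::complex) e"
    using e(1) by (auto simp: norm_divide)
  then obtain x where x: "x \<in> unit_disc" "- of_real (e / 2) = ?H x"
    using e(2) by blast
  have fx: "f x \<noteq> 0" using x(2) e(1) by auto
  then have H: "?H x = exp (of_real m * Ln (f x))" by (simp add: powr_def)
  \<comment> \<open>Here \<open>m < 1\<close> enters: the argument of the power is at most
    \<open>m * pi\<close> in modulus, whereas the negative number \<open>- e / 2\<close> has
    argument \<open>pi\<close>.\<close>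
  have "Im (of_real m * Ln (f x)) < pi \<and> - pi < Im (of_real m * Ln (f x))"
  proof -
    have "\<bar>m * Im (Ln (f x))\<bar> \<le> m * pi"
      using mpi_less_Im_Ln[OF fx] Im_Ln_le_pi[OF fx] m
      by (simp add: abs_mult mult_left_mono abs_le_iff)
    also have "m * pi < pi" using m by simp
    finally show ?thesis by (auto simp: abs_less_iff)
  qed
  then have "Ln (?H x) = of_real m * Ln (f x)" "Im (Ln (?H x)) < pi"
    unfolding H by auto
  moreover have "Im (Ln (- of_real (e / 2))) = pi"
    using e(1) by (subst Im_Ln_eq_pi) auto
  ultimately show False using x(2) by simp
qed

subsection \<open>Starlike Loewner chains\<close>

text \<open>This is strict differentiability: near \<open>v\<close> the derivative of
  \<open>f x - deriv f v * x\<close> is small, so this function has a small Lipschitz constant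
  there. Both points of the quotient may move, which is needed for two solutions that collide in a
  limit.\<close>

lemma divided_difference_tendsto:
  fixes f :: "complex \<Rightarrow> complex"
  assumes "f holomorphic_on S" "open S" "v \<in> S"
    and a: "a \<longlonglongrightarrow> v" and b: "b \<longlonglongrightarrow> v" and ne: "\<And>n. a n \<noteq> b n"
  shows "(\<lambda>n. (f (a n) - f (b n)) / (a n - b n)) \<longlonglongrightarrow> deriv f v"
proof (rule LIMSEQ_I)
  fix r :: real assume "r > 0"
  have "isCont (deriv f) v"
    using assms by (metis analytic_at_imp_isCont analytic_deriv analytic_on_open
        analytic_on_subset bot.extremum insert_subset)
  then obtain d where d: "d > 0" "\<And>x. dist x v < d \<Longrightarrow> dist (deriv f x) (deriv f v) < r / 2"
    unfolding continuous_at_eps_delta using \<open>r > 0\<close> by (meson half_gt_zero)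
  obtain d' where d': "d' > 0" "ball v d' \<subseteq> S" using assms openE by blast
  define e where "e = min d d'"
  have e: "e > 0" using d d' by (auto simp: e_def)
  have bd: "norm ((f x - deriv f v * x) - (f y - deriv f v * y)) \<le> r / 2 * norm (x - y)"
    if "x \<in> ball v e" "y \<in> ball v e" for x y
  proof (rule field_differentiable_bound[of "ball v e" _ "\<lambda>z. deriv f z - deriv f v"])
    fix z assume z: "z \<in> ball v e"
    have "(f has_field_derivative deriv f z) (at z)"
      using assms z d' by (intro holomorphic_derivI[OF assms(1,2)]) (auto simp: e_def)
    then have "((\<lambda>x. f x - deriv f v * x) has_field_derivative deriv f z - deriv f v) (at z)"
      by (auto intro!: derivative_eq_intros)
    then show "((\<lambda>x. f x - deriv f v * x) has_field_derivative deriv f z - deriv f v)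
        (at z within ball v e)"
      by (rule has_field_derivative_at_within)
    show "norm (deriv f z - deriv f v) \<le> r / 2"
      using d(2)[of z] z by (auto simp: e_def dist_norm norm_minus_commute less_imp_le)
  qed (use that in auto)
  obtain N where N: "\<And>n. n \<ge> N \<Longrightarrow> a n \<in> ball v e \<and> b n \<in> ball v e"
  proof -
    have "eventually (\<lambda>n. a n \<in> ball v e) sequentially" "eventually (\<lambda>n. b n \<in> ball v e) sequentially"
      using a b e topological_tendstoD[of _ v sequentially "ball v e"] by auto
    then have "eventually (\<lambda>n. a n \<in> ball v e \<and> b n \<in> ball v e) sequentially"
      by (rule eventually_conj)
    then show thesis using that unfolding eventually_sequentially by blast
  qed
  show "\<exists>N. \<forall>n\<ge>N. norm ((f (a n) - f (b n)) / (a n - b n) - deriv f v) < r"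
  proof (intro exI allI impI)
    fix n assume "n \<ge> N"
    have n0: "a n - b n \<noteq> 0" using ne by simp
    have "(f (a n) - f (b n)) / (a n - b n) - deriv f v
        = ((f (a n) - deriv f v * a n) - (f (b n) - deriv f v * b n)) / (a n - b n)"
      using n0 by (simp add: field_simps)
    then have "norm ((f (a n) - f (b n)) / (a n - b n) - deriv f v) \<le> r / 2"
      using bd[of "a n" "b n"] N[OF \<open>n \<ge> N\<close>] n0
      by (simp add: norm_divide pos_divide_le_eq)
    then show "norm ((f (a n) - f (b n)) / (a n - b n) - deriv f v) < r" using \<open>r > 0\<close> by simp
  qed
qed

text \<open>The local inverse \<open>g\<close> of \<open>u\<close> at \<open>v\<close> satisfies
  d/de |g(e)|^2 = 2 Re (v u'(v)) / |u'(v)|^2 at \<open>e0\<close>, which is positive. Lowering the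
  real value \<open>e\<close> therefore moves the solution of \<open>u z = e\<close> towards the
  origin.\<close>

lemma level_point_norm_decreases:
  fixes u :: "complex \<Rightarrow> complex"
  assumes hol: "u holomorphic_on S" and S: "open S" "v \<in> S" and uv: "u v = of_real e0"
    and pos: "Re (v * deriv u v) > 0" and "r > 0"
  shows "\<exists>t>0. \<forall>e. e0 - t < e \<and> e < e0 \<longrightarrow>
           (\<exists>z\<in>S \<inter> ball v r. norm z < norm v \<and> u z = of_real e)"
proof -
  have d0: "deriv u v \<noteq> 0" using pos by auto
  have hol': "u holomorphic_on S \<inter> ball v r" using hol by (rule holomorphic_on_subset) auto
  obtain s where s: "s > 0" "ball v s \<subseteq> S \<inter> ball v r" "inj_on u (ball v s)"
    using has_complex_derivative_locally_injective[OF hol' _ _ d0] S \<open>r > 0\<close>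
    by (metis IntI centre_in_ball open_Int open_ball)
  have hols: "u holomorphic_on ball v s" using hol' s(2) by (rule holomorphic_on_subset)
  obtain g where g: "g holomorphic_on (u ` ball v s)"
      "\<And>z. z \<in> ball v s \<Longrightarrow> deriv u z * deriv g (u z) = 1"
      "\<And>z. z \<in> ball v s \<Longrightarrow> g (u z) = z"
    using holomorphic_has_inverse[OF hols _ s(3)] by auto
  have op: "open (u ` ball v s)"
    by (rule open_mapping_thm3[OF hols _ s(3)]) auto
  have vin: "v \<in> ball v s" using s(1) by simp
  have g0: "g (of_real e0) = v" using g(3)[OF vin] uv by simp
  define d where "d = deriv g (of_real e0)"
  have d: "deriv u v * d = 1" using g(2)[OF vin] uv by (simp add: d_def)
  have "(g has_field_derivative d) (at (of_real e0))"
    unfolding d_def using vin uv by (intro holomorphic_derivI[OF g(1) op]) (metis imageI)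
  then have vd: "((\<lambda>x. g (of_real x)) has_vector_derivative d) (at e0)"
    using has_vector_derivative_real_field[of g d e0] by auto
  have "((\<lambda>x. g (of_real x) \<bullet> g (of_real x)) has_real_derivative 2 * (v \<bullet> d)) (at e0)"
    using has_derivative_inner[OF vd[unfolded has_vector_derivative_def] vd[unfolded has_vector_derivative_def]]
    unfolding has_field_derivative_def
    by (rule has_derivative_eq_rhs) (auto simp: g0 inner_commute fun_eq_iff)
  moreover have "2 * (v \<bullet> d) > 0"
  proof -
    have "d = inverse (deriv u v)" using d by (simp add: inverse_unique)
    then have "v \<bullet> d = Re (v * deriv u v) / (norm (deriv u v))\<^sup>2"
      by (simp add: inner_complex_def cmod_def inverse_complex.code divide_simps)
    then show ?thesis using pos d0 by simp
  qed
  ultimately obtain t1 where t1: "t1 > 0"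
      "\<And>h. 0 < h \<Longrightarrow> h < t1 \<Longrightarrow> g (of_real (e0 - h)) \<bullet> g (of_real (e0 - h)) < v \<bullet> v"
    using DERIV_pos_inc_left[of "\<lambda>x. g (of_real x) \<bullet> g (of_real x)"] g0 by fastforce
  obtain t2 where t2: "t2 > 0" "ball (of_real e0) t2 \<subseteq> u ` ball v s"
    using op vin uv openE by (metis imageI)
  show ?thesis
  proof (intro exI[of _ "min t1 t2"] conjI allI impI)
    show "min t1 t2 > 0" using t1 t2 by simp
    fix e assume e: "e0 - min t1 t2 < e \<and> e < e0"
    have "of_real e \<in> ball (of_real e0 :: complex) t2"
      using e by (auto simp: dist_real_def)
    then obtain z where z: "z \<in> ball v s" "u z = of_real e" using t2(2) by fastforce
    have "z \<bullet> z < v \<bullet> v"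
      using t1(2)[of "e0 - e"] e g(3)[OF z(1)] z(2) by auto
    then have "norm z < norm v" by (simp add: norm_lt)
    then show "\<exists>z\<in>S \<inter> ball v r. norm z < norm v \<and> u z = of_real e"
      using z s(2) by blast
  qed
qed

text \<open>The starlike function is z V; its zero at the origin is split off so that
  \<open>V\<close> can serve as a denominator everywhere. The assumption \<open>starlike\<close>
  reads Re (z (z V)' / (z V)) > 0, and \<open>transversal\<close> makes T close-to-convex with
  respect to z V.\<close>

locale starlike_chain =
  fixes V T :: "complex \<Rightarrow> complex"
  assumes V_hol: "V holomorphic_on unit_disc" and T_hol: "T holomorphic_on unit_disc"
    and V_nz: "z \<in> unit_disc \<Longrightarrow> V z \<noteq> 0"
    and starlike: "z \<in> unit_disc \<Longrightarrow> Re (1 + z * deriv V z / V z) > 0"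
    and transversal: "z \<in> unit_disc \<Longrightarrow> Re (deriv T z / V z) > 0"
begin

text \<open>For \<open>e > 0\<close> and t = 1 / e this is the Loewner condition for L = T + t z V:
  the quotient of z times the z-derivative by the t-derivative of L is t times the expression here.
  For \<open>e = 0\<close> only starlikeness remains.\<close>

lemma Re_chain_pos:
  assumes "z \<in> unit_disc" "e \<ge> 0"
  shows "Re ((V z + z * deriv V z + of_real e * deriv T z) / V z) > 0"
proof -
  have "(V z + z * deriv V z + of_real e * deriv T z) / V z
      = (1 + z * deriv V z / V z) + of_real e * (deriv T z / V z)"
    using V_nz[OF assms(1)] by (simp add: field_simps)
  moreover have "Re (of_real e * (deriv T z / V z)) \<ge> 0"
  proof -
    have "Re (of_real e * w) = e * Re w" for w by simp
    then show ?thesis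
      using mult_nonneg_nonneg[OF \<open>e \<ge> 0\<close> less_imp_le[OF transversal[OF assms(1)]]] by metis
  qed
  ultimately show ?thesis
    using starlike[OF assms(1)] by simp
qed

text \<open>
  With \<open>e = 1 / t\<close>, the equation \<open>z V z + e (T z - c) = 0\<close> says that \<open>c\<close> is the value at \<open>z\<close> of the
  member \<open>T + t z V\<close> of the Loewner chain. Following a solution as \<open>e\<close> decreases
  replaces the flow of the chain.
\<close>
lemma chain_solution_persists:
  assumes v: "v \<in> unit_disc" and e0: "e0 > 0" and eq: "v * V v + of_real e0 * (T v - c) = 0"
    and "r > 0"
  shows "\<exists>t>0. \<forall>e. e0 - t < e \<and> e < e0 \<longrightarrow>
    (\<exists>z\<in>ball v r. norm z \<le> norm v \<and> z * V z + of_real e * (T z - c) = 0)"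
proof (cases "v = 0")
  case True
  \<comment> \<open>In this case \<open>0\<close> solves the equation for every
    \<open>e\<close>.\<close>
  then have "T 0 = c" using eq e0 by simp
  then show ?thesis using True \<open>r > 0\<close> by (intro exI[of _ 1]) auto
next
  case False
  define S where "S = {z \<in> unit_disc. T z \<noteq> c}"
  \<comment> \<open>The equation solved for \<open>e\<close>: its solutions in \<open>S\<close> are
    the points where \<open>u\<close> takes the real value \<open>e\<close>.\<close>
  define u where "u = (\<lambda>z. - (z * V z) / (T z - c))"
  have "open S"
  proof -
    have "S = unit_disc \<inter> T -` (- {c})" by (auto simp: S_def)
    then show ?thesis
      using continuous_open_preimage[OF holomorphic_on_imp_continuous_on[OF T_hol]] by auto
  qed
  have "v * V v \<noteq> 0" using False V_nz[OF v] by simp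
  then have "T v \<noteq> c" using eq by auto
  then have vS: "v \<in> S" using v by (simp add: S_def)
  have eq': "- (v * V v) = of_real e0 * (T v - c)"
    using eq by (metis neg_eq_iff_add_eq_0)
  then have uv: "u v = of_real e0"
    using \<open>T v \<noteq> c\<close> by (simp only: u_def) simp
  have uhol: "u holomorphic_on S"
    unfolding u_def
    by (intro holomorphic_intros holomorphic_on_subset[OF V_hol] holomorphic_on_subset[OF T_hol])
       (auto simp: S_def)
  have dV: "(V has_field_derivative deriv V v) (at v)" and dT: "(T has_field_derivative deriv T v) (at v)"
    using V_hol T_hol v by (auto intro: holomorphic_derivI)
  \<comment> \<open>\<open>J\<close> is the quantity of \<open>Re_chain_pos\<close>. Eliminating
    \<open>D\<close> by means of the equation at \<open>v\<close> gives
    \<open>v * deriv u v = of_real e0 * J\<close>, as \<open>level_point_norm_decreases\<close>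
    requires.\<close>
  define J where "J = (V v + v * deriv V v + of_real e0 * deriv T v) / V v"
  define D where "D = T v - c"
  define N where "N = V v + v * deriv V v + of_real e0 * deriv T v"
  have D: "D \<noteq> 0" "v * V v = - (of_real e0 * D)"
    using \<open>T v \<noteq> c\<close> eq' by (auto simp: D_def eq'[symmetric])
  have "(u has_field_derivative
      (- (V v + v * deriv V v) * D - (- (v * V v)) * deriv T v) / (D * D)) (at v)"
  proof -
    have "((\<lambda>z. - (z * V z)) has_field_derivative - (V v + v * deriv V v)) (at v)"
      using dV by (auto intro!: derivative_eq_intros)
    moreover have "((\<lambda>z. T z - c) has_field_derivative deriv T v) (at v)"
      using dT by (auto intro!: derivative_eq_intros)
    ultimately show ?thesis
      unfolding u_def D_def using \<open>T v \<noteq> c\<close> by (intro DERIV_divide) auto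
  qed
  also have "(- (V v + v * deriv V v) * D - (- (v * V v)) * deriv T v) / (D * D) = - N / D"
  proof -
    have "- (V v + v * deriv V v) * D - (- (v * V v)) * deriv T v = - N * D"
      unfolding D(2) N_def by (simp add: algebra_simps)
    then show ?thesis using D(1) by simp
  qed
  also have "- N / D = of_real e0 * J / v"
  proof -
    have "- N * (v * V v) = of_real e0 * N * D" by (simp add: D(2))
    then have "- N / D = of_real e0 * N / (v * V v)"
      using D(1) \<open>v * V v \<noteq> 0\<close> frac_eq_eq by blast
    then show ?thesis by (simp add: J_def N_def mult.commute)
  qed
  finally have "(u has_field_derivative of_real e0 * J / v) (at v)" .
  then have "v * deriv u v = of_real e0 * J"
    using False by (simp add: DERIV_imp_deriv)
  then have "Re (v * deriv u v) > 0"
  proof -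
    have "Re (of_real e0 * J) = e0 * Re J" by simp
    moreover have "Re J > 0" unfolding J_def using Re_chain_pos[OF v] e0 by simp
    ultimately show ?thesis using e0 \<open>v * deriv u v = of_real e0 * J\<close> by simp
  qed
  from level_point_norm_decreases[OF uhol \<open>open S\<close> vS uv this \<open>r > 0\<close>]
  obtain t where t: "t > 0"
    "\<And>e. e0 - t < e \<Longrightarrow> e < e0 \<Longrightarrow> \<exists>z\<in>S \<inter> ball v r. norm z < norm v \<and> u z = of_real e"
    by blast
  show ?thesis
  proof (intro exI[of _ t] conjI allI impI t)
    fix e assume "e0 - t < e \<and> e < e0"
    then obtain z where z: "z \<in> S" "z \<in> ball v r" "norm z < norm v" "u z = of_real e"
      using t(2)[of e] by blast
    then have "T z - c \<noteq> 0" "- (z * V z) / (T z - c) = of_real e"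
      by (simp_all only: u_def S_def) auto
    then have "z * V z + of_real e * (T z - c) = 0"
      by (metis nonzero_divide_eq_eq neg_eq_iff_add_eq_0)
    then show "\<exists>z\<in>ball v r. norm z \<le> norm v \<and> z * V z + of_real e * (T z - c) = 0"
      using z by (intro bexI[of _ z]) auto
  qed
qed

lemma continuous_on_V: "S \<subseteq> unit_disc \<Longrightarrow> continuous_on S V"
  and continuous_on_T: "S \<subseteq> unit_disc \<Longrightarrow> continuous_on S T"
  using holomorphic_on_imp_continuous_on[OF V_hol] holomorphic_on_imp_continuous_on[OF T_hol]
  by (auto intro: continuous_on_subset)

text \<open>The right-hand side is the value at \<open>z0\<close> of the chain member with t = 1 /
  m. The pairs of a solution in the closed disc and a parameter in [1, m] form a compact set, so
  there is a least parameter; by \<open>chain_solution_persists\<close> it cannot exceed 1.\<close>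

lemma chain_subset:
  assumes "norm z0 \<le> s" "s < 1" "m \<ge> 1"
  shows "\<exists>z\<in>cball 0 s. T z + z * V z = T z0 + z0 * V z0 / of_real m"
proof -
  define c where "c = T z0 + z0 * V z0 / of_real m"
  define f where "f x = fst x * V (fst x) + complex_of_real (snd x) * (T (fst x) - c)" for x
  define K where "K = {x \<in> cball 0 s \<times> {1..m}. f x = 0}"
  have cb: "cball 0 s \<subseteq> unit_disc" using \<open>s < 1\<close> by auto
  have "continuous_on (cball 0 s \<times> {1..m}) (\<lambda>x. V (fst x))"
    "continuous_on (cball 0 s \<times> {1..m}) (\<lambda>x. T (fst x))"
    by (auto intro!: continuous_on_compose2[OF continuous_on_V[OF cb]]
        continuous_on_compose2[OF continuous_on_T[OF cb]] continuous_on_fst continuous_on_id)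
  then have "continuous_on (cball 0 s \<times> {1..m}) f"
    unfolding f_def by (intro continuous_intros)
  then have "closed K"
    unfolding K_def by (rule continuous_closed_preimage_constant) (intro closed_Times closed_cball closed_atLeastAtMost)
  moreover have "compact (cball (0::complex) s \<times> {1..m})"
    by (intro compact_Times compact_cball compact_Icc)
  moreover have "K = (cball 0 s \<times> {1..m}) \<inter> K" by (auto simp: K_def)
  ultimately have "compact K" using compact_Int_closed by metis
  moreover have "(z0, m) \<in> K"
    using assms by (auto simp: K_def f_def c_def)
  ultimately obtain x where x: "x \<in> K" "\<And>y. y \<in> K \<Longrightarrow> snd x \<le> snd y"
    using continuous_attains_inf[of K snd] continuous_on_snd[OF continuous_on_id]
    by (metis empty_iff)
  obtain v e where ve: "x = (v, e)" by force
  have v: "v \<in> cball 0 s" "1 \<le> e" "e \<le> m" "v * V v + of_real e * (T v - c) = 0"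
    using x(1) by (simp_all add: ve K_def f_def)
  have "e = 1"
  proof (rule ccontr)
    assume "e \<noteq> 1"
    have "v \<in> unit_disc" "e > 0" using v(1,2) cb by auto
    from chain_solution_persists[OF this v(4) zero_less_one]
    obtain t where t: "t > 0" "\<And>e'. e - t < e' \<Longrightarrow> e' < e \<Longrightarrow>
        \<exists>z. norm z \<le> norm v \<and> z * V z + of_real e' * (T z - c) = 0"
      by blast
    define e' where "e' = max 1 (e - t / 2)"
    have e': "1 \<le> e'" "e' < e" "e - t < e'"
      using t(1) v(2) \<open>e \<noteq> 1\<close> by (auto simp: e'_def)
    then obtain z where "norm z \<le> norm v" "z * V z + of_real e' * (T z - c) = 0"
      using t(2) by blast
    then have "(z, e') \<in> K" using e' v by (auto simp: K_def f_def)
    then show False using x(2)[of "(z, e')"] e' by (simp add: ve)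
  qed
  then have "T v + v * V v = c" using v(4) by (simp add: algebra_simps)
  then show ?thesis using v(1) by (auto simp: c_def)
qed

text \<open>
  A pair of distinct solutions persists down to \<open>e = 0\<close>, where the only solution is \<open>0\<close>; the
  nonvanishing of the derivative keeps the two solutions apart in the limit.
\<close>
lemma chain_inj: "inj_on (\<lambda>z. T z + z * V z) unit_disc"
proof (rule inj_onI, rule ccontr)
  fix a0 b0 :: complex
  assume ab: "a0 \<in> unit_disc" "b0 \<in> unit_disc" "T a0 + a0 * V a0 = T b0 + b0 * V b0" "a0 \<noteq> b0"
  define c where "c = T a0 + a0 * V a0"
  define s where "s = max (norm a0) (norm b0)"
  have s: "s < 1" "norm a0 \<le> s" "norm b0 \<le> s" using ab by (auto simp: s_def)
  have cb: "cball 0 s \<subseteq> unit_disc" using \<open>s < 1\<close> by auto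
  define f where "f e z = z * V z + complex_of_real e * (T z - c)" for e z
  define P where "P e a b \<longleftrightarrow> a \<in> cball 0 s \<and> b \<in> cball 0 s \<and> a \<noteq> b \<and> f e a = 0 \<and> f e b = 0"
    for e a b
  \<comment> \<open>The parameters that admit two distinct solutions in the closed disc. A limit of
    such pairs is a pair at \<open>E = Inf I\<close>; if \<open>E > 0\<close>, it would persist to a
    smaller parameter.\<close>
  define I where "I = {e. 0 \<le> e \<and> e \<le> 1 \<and> (\<exists>a b. P e a b)}"
  have "f 1 z = (T z + z * V z) - c" for z by (simp add: f_def)
  then have "P 1 a0 b0" using ab s unfolding P_def c_def by simp
  then have "1 \<in> I" unfolding I_def by auto
  define E where "E = Inf I"
  have bdd: "bdd_below I" by (auto simp: I_def intro!: bdd_belowI[of _ 0])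
  have E: "0 \<le> E" "E \<le> 1"
    using \<open>1 \<in> I\<close> bdd by (auto simp: E_def I_def intro!: cInf_greatest cInf_lower)
  have "\<exists>e\<in>I. e < E + 1 / real (Suc n)" for n
    using cInf_lessD[of I "E + 1 / real (Suc n)"] \<open>1 \<in> I\<close> by (auto simp: E_def)
  then obtain \<epsilon> where \<epsilon>: "\<And>n. \<epsilon> n \<in> I" "\<And>n. \<epsilon> n < E + 1 / real (Suc n)" by metis
  have "\<epsilon> \<longlonglongrightarrow> E"
  proof (rule tendsto_sandwich[of "\<lambda>_. E" _ _ "\<lambda>n. E + 1 / real (Suc n)"])
    show "(\<lambda>n. E + 1 / real (Suc n)) \<longlonglongrightarrow> E"
      using tendsto_add[OF tendsto_const LIMSEQ_inverse_real_of_nat, of E] by (simp add: inverse_eq_divide)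
    show "\<forall>\<^sub>F n in sequentially. E \<le> \<epsilon> n"
      unfolding E_def using \<epsilon>(1) bdd by (intro always_eventually allI cInf_lower)
    show "\<forall>\<^sub>F n in sequentially. \<epsilon> n \<le> E + 1 / real (Suc n)"
      using \<epsilon>(2) less_imp_le by (intro always_eventually allI) blast
  qed simp
  obtain a b where P: "\<And>n. P (\<epsilon> n) (a n) (b n)" using \<epsilon>(1) unfolding I_def by simp metis
  have "compact (cball (0::complex) s \<times> cball (0::complex) s)" by (intro compact_Times compact_cball)
  moreover have "\<forall>n. (a n, b n) \<in> cball 0 s \<times> cball 0 s" using P by (auto simp: P_def)
  ultimately obtain l and r :: "nat \<Rightarrow> nat" where l: "l \<in> cball 0 s \<times> cball 0 s" "strict_mono r"
      "((\<lambda>n. (a n, b n)) \<circ> r) \<longlonglongrightarrow> l"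
    using seq_compactE[OF compact_imp_seq_compact, of "cball 0 s \<times> cball 0 s" "\<lambda>n. (a n, b n)"]
    by blast
  obtain A B where AB: "l = (A, B)" by force
  have A: "A \<in> cball 0 s" "(\<lambda>n. a (r n)) \<longlonglongrightarrow> A" and B: "B \<in> cball 0 s" "(\<lambda>n. b (r n)) \<longlonglongrightarrow> B"
    using l(1) tendsto_fst[OF l(3)] tendsto_snd[OF l(3)] by (auto simp: AB o_def)
  have e: "(\<lambda>n. \<epsilon> (r n)) \<longlonglongrightarrow> E"
    using LIMSEQ_subseq_LIMSEQ[OF \<open>\<epsilon> \<longlonglongrightarrow> E\<close> l(2)] by (simp add: o_def)
  have lim: "f E x = 0" if "x \<in> cball 0 s" "(\<lambda>n. y (r n)) \<longlonglongrightarrow> x" "\<And>n. y n \<in> cball 0 s" "\<And>n. f (\<epsilon> n) (y n) = 0" for x y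
  proof -
    have "(\<lambda>n. V (y (r n))) \<longlonglongrightarrow> V x" "(\<lambda>n. T (y (r n))) \<longlonglongrightarrow> T x"
      using continuous_on_tendsto_compose[OF continuous_on_V[OF cb] that(2,1)]
        continuous_on_tendsto_compose[OF continuous_on_T[OF cb] that(2,1)] that(3) by simp_all
    then have "(\<lambda>n. f (\<epsilon> (r n)) (y (r n))) \<longlonglongrightarrow> f E x"
      unfolding f_def by (intro tendsto_intros that e)
    then show ?thesis using that(4) LIMSEQ_const_iff[of 0 "f E x"] by simp
  qed
  have fA: "f E A = 0" and fB: "f E B = 0"
    using lim[OF A] lim[OF B] P by (auto simp: P_def)
  have "A \<noteq> B"
  proof
    assume "A = B"
    have AD: "A \<in> unit_disc" using A cb by auto
    have ne: "a (r n) \<noteq> b (r n)" for n using P by (auto simp: P_def)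
    have "(\<lambda>z. z * V z) holomorphic_on unit_disc" by (intro holomorphic_intros V_hol)
    from divided_difference_tendsto[OF this open_ball AD A(2) B(2)[folded \<open>A = B\<close>] ne]
      divided_difference_tendsto[OF T_hol open_ball AD A(2) B(2)[folded \<open>A = B\<close>] ne]
    have "(\<lambda>n. (a (r n) * V (a (r n)) - b (r n) * V (b (r n))) / (a (r n) - b (r n)) + of_real (\<epsilon> (r n)) *
            ((T (a (r n)) - T (b (r n))) / (a (r n) - b (r n))))
        \<longlonglongrightarrow> deriv (\<lambda>z. z * V z) A + of_real E * deriv T A"
      by (intro tendsto_intros e)
    \<comment> \<open>Subtracting the two equations removes \<open>c\<close>, and the difference is
      then divided by the nonzero distance \<open>a (r n) - b (r n)\<close>.\<close>
    moreover have "(a (r n) * V (a (r n)) - b (r n) * V (b (r n))) / (a (r n) - b (r n)) + of_real (\<epsilon> (r n)) *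
            ((T (a (r n)) - T (b (r n))) / (a (r n) - b (r n))) = 0" for n
    proof -
      have "f (\<epsilon> (r n)) (a (r n)) - f (\<epsilon> (r n)) (b (r n)) = 0" using P by (auto simp: P_def)
      then have "(a (r n) * V (a (r n)) - b (r n) * V (b (r n))) + of_real (\<epsilon> (r n)) *
            (T (a (r n)) - T (b (r n))) = 0"
        by (simp add: f_def algebra_simps)
      then show ?thesis
        by (metis add_divide_distrib div_0 times_divide_eq_right)
    qed
    ultimately have "deriv (\<lambda>z. z * V z) A + of_real E * deriv T A = 0"
      using LIMSEQ_const_iff[of 0 "deriv (\<lambda>z. z * V z) A + of_real E * deriv T A"] by simp
    moreover have "deriv (\<lambda>z. z * V z) A = V A + A * deriv V A"
      using holomorphic_derivI[OF V_hol open_ball AD]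
      by (intro DERIV_imp_deriv) (auto intro!: derivative_eq_intros)
    ultimately show False using Re_chain_pos[OF AD E(1)] by simp
  qed
  then have PE: "P E A B" using A B fA fB by (simp add: P_def)
  show False
  proof (cases "E = 0")
    case True
    \<comment> \<open>For parameter 0 the equation is \<open>z * V z = 0\<close>.\<close>
    have "A = 0" "B = 0"
      using fA fB V_nz[of A] V_nz[of B] A B cb unfolding f_def True by auto
    then show False using \<open>A \<noteq> B\<close> by simp
  next
    case False
    \<comment> \<open>Balls of this radius about \<open>A\<close> and \<open>B\<close> are disjoint,
      so the two continued solutions stay distinct.\<close>
    define d where "d = dist A B / 2"
    have d: "d > 0" using \<open>A \<noteq> B\<close> by (simp add: d_def)
    have E0: "E > 0" using False E by simp
    have AD: "A \<in> unit_disc" "B \<in> unit_disc" using A B cb by auto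
    obtain t1 where t1: "t1 > 0" "\<And>e. E - t1 < e \<Longrightarrow> e < E \<Longrightarrow> \<exists>z\<in>ball A d. norm z \<le> norm A \<and> f e z = 0"
      using chain_solution_persists[OF AD(1) E0 fA[unfolded f_def] d] unfolding f_def by blast
    obtain t2 where t2: "t2 > 0" "\<And>e. E - t2 < e \<Longrightarrow> e < E \<Longrightarrow> \<exists>z\<in>ball B d. norm z \<le> norm B \<and> f e z = 0"
      using chain_solution_persists[OF AD(2) E0 fB[unfolded f_def] d] unfolding f_def by blast
    define e where "e = max 0 (E - min t1 t2 / 2)"
    have e: "0 \<le> e" "e < E" "E - t1 < e" "E - t2 < e"
      using t1(1) t2(1) E0 by (auto simp: e_def)
    obtain x where x: "x \<in> ball A d" "norm x \<le> norm A" "f e x = 0" using t1(2) e by blast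
    obtain y where y: "y \<in> ball B d" "norm y \<le> norm B" "f e y = 0" using t2(2) e by blast
    have "x \<noteq> y"
      using x(1) y(1) dist_triangle2[of A B x] by (auto simp: d_def)
    then have "P e x y" using x y A(1) B(1) by (simp add: P_def)
    then have "e \<in> I" using e E by (auto simp: I_def)
    then have "E \<le> e" unfolding E_def using bdd by (intro cInf_lower)
    then show False using e by simp
  qed
qed

end

subsection \<open>Jack's lemma and the first exit point\<close>

lemma norm_squared_along_path:
  fixes w :: "complex \<Rightarrow> complex" and c :: "real \<Rightarrow> complex"
  assumes "(w has_field_derivative d) (at (c t))" "(c has_vector_derivative e) (at t)"
  shows "((\<lambda>x. (norm (w (c x)))\<^sup>2) has_real_derivative 2 * (w (c t) \<bullet> (e * d))) (at t)"
proof -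
  have v: "((w \<circ> c) has_vector_derivative e * d) (at t)"
    using field_vector_diff_chain_at[OF assms(2,1)] .
  have "((\<lambda>x. (w \<circ> c) x \<bullet> (w \<circ> c) x) has_real_derivative 2 * (w (c t) \<bullet> (e * d))) (at t)"
    using has_derivative_inner[OF v[unfolded has_vector_derivative_def] v[unfolded has_vector_derivative_def]]
    unfolding has_field_derivative_def
    by (rule has_derivative_eq_rhs) (auto simp: inner_commute fun_eq_iff)
  then show ?thesis by (simp add: power2_norm_eq_inner)
qed

text \<open>At a maximum of |w| on the circle the tangential derivative of |w|^2 vanishes, so the
  conjugate of \<open>w z0\<close> times \<open>z0 * deriv w z0\<close> is real. Schwarz's lemma
  bounds |w| linearly along the radius, and the radial derivative then makes that real number at
  least \<open>\<rho>\<close> squared.\<close>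

lemma Jack_lemma:
  fixes w :: "complex \<Rightarrow> complex"
  assumes hol: "w holomorphic_on U" and U: "open U" "cball 0 s \<subseteq> U" and "w 0 = 0" and "\<rho> > 0"
    and lt: "\<And>z. norm z < s \<Longrightarrow> norm (w z) < \<rho>"
    and le: "\<And>z. norm z \<le> s \<Longrightarrow> norm (w z) \<le> \<rho>"
    and z0: "norm z0 = s" "norm (w z0) = \<rho>"
  shows "\<exists>m\<ge>1. z0 * deriv w z0 = of_real m * w z0"
proof -
  have "s > 0" using z0 assms(4,5) by (metis norm_eq_zero norm_ge_zero order_less_le)
  define d where "d = deriv w z0"
  have "z0 \<in> U" using z0 U by auto
  then have dw: "(w has_field_derivative d) (at z0)"
    unfolding d_def by (intro holomorphic_derivI[OF hol U(1)])
  have schwarz: "norm (w (of_real x * z0)) \<le> \<rho> * x" if "0 \<le> x" "x < 1" for x :: real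
  proof -
    define f where "f = (\<lambda>z. w (of_real s * z) / of_real \<rho>)"
    have sz: "norm (of_real s * z) < s" if "norm z < 1" for z :: complex
      using that \<open>s > 0\<close> by (simp add: norm_mult)
    have "f holomorphic_on ball 0 1"
    proof -
      have "(w \<circ> (\<lambda>z. of_real s * z)) holomorphic_on ball 0 1"
        using sz U(2) by (intro holomorphic_on_compose_gen[OF _ hol] holomorphic_intros) force
      then have "(\<lambda>z. w (of_real s * z)) holomorphic_on ball 0 1" by (simp add: o_def)
      then show ?thesis
        unfolding f_def using \<open>\<rho> > 0\<close> by (intro holomorphic_on_divide holomorphic_on_const) auto
    qed
    moreover have "f 0 = 0" by (simp add: f_def \<open>w 0 = 0\<close>)
    moreover have "norm (f z) < 1" if "norm z < 1" for z
      using lt[OF sz[OF that]] \<open>\<rho> > 0\<close> by (simp add: f_def norm_divide)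
    moreover have n: "norm (of_real x * (z0 / of_real s)) = x"
      using that z0 \<open>s > 0\<close> by (simp add: norm_mult norm_divide)
    ultimately have "norm (f (of_real x * (z0 / of_real s))) \<le> x"
      using Schwarz_Lemma(1)[of f "of_real x * (z0 / of_real s)"] that by simp
    moreover have "norm (w (of_real x * z0)) = \<rho> * norm (f (of_real x * (z0 / of_real s)))"
      using \<open>s > 0\<close> \<open>\<rho> > 0\<close> by (simp add: f_def norm_divide)
    ultimately show ?thesis using \<open>\<rho> > 0\<close> by simp
  qed
  have radial: "w z0 \<bullet> (z0 * d) \<ge> \<rho>\<^sup>2"
  proof (rule ccontr)
    assume "\<not> w z0 \<bullet> (z0 * d) \<ge> \<rho>\<^sup>2"
    have "((\<lambda>x. of_real x * z0) has_vector_derivative z0) (at 1)"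
      by (auto intro!: derivative_eq_intros)
    from norm_squared_along_path[OF _ this, of w d] dw
    have "((\<lambda>x. (norm (w (of_real x * z0)))\<^sup>2) has_real_derivative 2 * (w z0 \<bullet> (z0 * d))) (at 1)"
      by simp
    moreover have "((\<lambda>x. \<rho>\<^sup>2 * x\<^sup>2) has_real_derivative 2 * \<rho>\<^sup>2) (at 1)"
      by (auto intro!: derivative_eq_intros)
    \<comment> \<open>This difference vanishes at 1. With a negative derivative there it would be
      positive just before 1, contrary to \<open>schwarz\<close>.\<close>
    ultimately have "((\<lambda>x. (norm (w (of_real x * z0)))\<^sup>2 - \<rho>\<^sup>2 * x\<^sup>2) has_real_derivative
        2 * (w z0 \<bullet> (z0 * d)) - 2 * \<rho>\<^sup>2) (at 1)"
      by (rule DERIV_diff)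
    moreover have "2 * (w z0 \<bullet> (z0 * d)) - 2 * \<rho>\<^sup>2 < 0"
      using \<open>\<not> w z0 \<bullet> (z0 * d) \<ge> \<rho>\<^sup>2\<close> by simp
    ultimately obtain h0 where h0: "h0 > 0" "\<And>h. 0 < h \<Longrightarrow> h < h0 \<Longrightarrow>
        (norm (w (of_real 1 * z0)))\<^sup>2 - \<rho>\<^sup>2 * 1\<^sup>2
          < (norm (w (of_real (1 - h) * z0)))\<^sup>2 - \<rho>\<^sup>2 * (1 - h)\<^sup>2"
      using DERIV_neg_dec_left by blast
    define h where "h = min 1 (h0 / 2)"
    have h: "0 < h" "h < h0" "h \<le> 1" using h0(1) by (auto simp: h_def)
    have "(norm (w (of_real (1 - h) * z0)))\<^sup>2 \<le> (\<rho> * (1 - h))\<^sup>2"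
      using h by (intro power_mono schwarz) auto
    then show False using h0(2)[OF h(1,2)] z0(2) by (simp add: power_mult_distrib)
  qed
  have tangential: "w z0 \<bullet> (\<i> * z0 * d) = 0"
  proof -
    \<comment> \<open>This curve runs along the circle through \<open>z0\<close>, where |w| is at
      most \<open>\<rho>\<close> with equality at \<open>t = 0\<close>.\<close>
    have "((\<lambda>t. exp (\<i> * of_real t) * z0) has_vector_derivative \<i> * z0) (at 0)"
      by (auto intro!: derivative_eq_intros has_vector_derivative_real_field)
    from norm_squared_along_path[OF _ this, of w d] dw
    have "((\<lambda>t. (norm (w (exp (\<i> * of_real t) * z0)))\<^sup>2) has_real_derivative
        2 * (w z0 \<bullet> (\<i> * z0 * d))) (at 0)"
      by simp
    moreover have "(norm (w (exp (\<i> * of_real t) * z0)))\<^sup>2 \<le> (norm (w (exp (\<i> * of_real 0) * z0)))\<^sup>2" for t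
      using le[of "exp (\<i> * of_real t) * z0"] z0 by (simp add: norm_mult power_mono)
    ultimately have "2 * (w z0 \<bullet> (\<i> * z0 * d)) = 0"
      by (intro DERIV_local_max[of "\<lambda>t. (norm (w (exp (\<i> * of_real t) * z0)))\<^sup>2" _ 0 1]) auto
    then show ?thesis by simp
  qed
  define a where "a = w z0 \<bullet> (z0 * d)"
  have "cnj (w z0) * (z0 * d) = of_real a"
    using tangential unfolding a_def
    by (simp add: complex_eq_iff inner_complex_def algebra_simps)
  then have "w z0 * cnj (w z0) * (z0 * d) = of_real a * w z0"
    by (metis mult.assoc mult.commute)
  moreover have "w z0 * cnj (w z0) = of_real (\<rho>\<^sup>2)"
    using z0(2) complex_norm_square[of "w z0"] by simp
  ultimately have "z0 * d = of_real (a / \<rho>\<^sup>2) * w z0"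
    using \<open>\<rho> > 0\<close> by (simp add: field_simps)
  moreover have "a / \<rho>\<^sup>2 \<ge> 1" using radial \<open>\<rho> > 0\<close> by (simp add: a_def divide_simps)
  ultimately show ?thesis unfolding d_def by blast
qed

text \<open>Here \<open>z0\<close> is a point of least modulus in the compact set where
  \<open>q\<close> lies outside the image of the smaller disc, and \<open>w\<close> is the inverse
  of \<open>p\<close> composed with \<open>q\<close>. Since \<open>\<rho> < 1\<close>,
  \<open>w\<close> is analytic on a neighbourhood of the closed disc of radius |z0|, so
  \<open>Jack_lemma\<close> applies.\<close>

lemma first_exit_point:
  fixes p q :: "complex \<Rightarrow> complex"
  assumes p: "p holomorphic_on unit_disc" "inj_on p unit_disc" and q: "q holomorphic_on unit_disc"
    and "q 0 = p 0" and \<rho>: "0 < \<rho>" "\<rho> < 1" and a: "a \<in> unit_disc" "q a \<notin> p ` ball 0 \<rho>"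
  obtains w z0 m where "norm z0 \<le> norm a" "continuous_on (cball 0 (norm z0)) w"
    "w ` cball 0 (norm z0) \<subseteq> cball 0 \<rho>" "w 0 = 0" "\<And>z. z \<in> cball 0 (norm z0) \<Longrightarrow> q z = p (w z)"
    "norm (w z0) = \<rho>" "m \<ge> (1::real)" "z0 * deriv q z0 = of_real m * (w z0 * deriv p (w z0))"
proof -
  have bsub: "ball 0 \<rho> \<subseteq> unit_disc" and cbsub: "cball 0 \<rho> \<subseteq> unit_disc" using \<rho> by auto
  have op: "open (p ` ball 0 \<rho>)"
    using holomorphic_on_subset[OF p(1) bsub] inj_on_subset[OF p(2) bsub] by (intro open_mapping_thm3) auto
  have asub: "cball 0 (norm a) \<subseteq> unit_disc" using a by auto
  have cq: "continuous_on unit_disc q" and cp: "continuous_on unit_disc p"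
    using q p holomorphic_on_imp_continuous_on by auto
  define X where "X = cball 0 (norm a) \<inter> q -` (- (p ` ball 0 \<rho>))"
  have "closed X"
    unfolding X_def using op continuous_on_subset[OF cq asub] by (intro continuous_closed_preimage) auto
  then have "compact (cball 0 (norm a) \<inter> X)" by (intro compact_Int_closed compact_cball)
  moreover have "cball 0 (norm a) \<inter> X = X" by (auto simp: X_def)
  ultimately have "compact X" by simp
  moreover have "X \<noteq> {}" using a by (auto simp: X_def)
  ultimately obtain z0 where z0: "z0 \<in> X" "\<And>y. y \<in> X \<Longrightarrow> norm z0 \<le> norm y"
    using continuous_attains_inf[of X norm] continuous_on_norm_id by blast
  define s where "s = norm z0"
  have sa: "s \<le> norm a" and qz0: "q z0 \<notin> p ` ball 0 \<rho>" using z0(1) by (auto simp: X_def s_def)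
  have inside: "q z \<in> p ` ball 0 \<rho>" if "norm z < s" for z
    using z0(2)[of z] that sa by (fastforce simp: X_def s_def)
  have "z0 \<noteq> 0" using qz0 \<open>q 0 = p 0\<close> \<rho> by (metis centre_in_ball imageI)
  then have "s > 0" by (simp add: s_def)
  have s1: "cball 0 s \<subseteq> unit_disc" using sa a by auto
  have "compact (p ` cball 0 \<rho>)"
    using continuous_on_subset[OF cp cbsub] by (intro compact_continuous_image compact_cball)
  then have "closed (p ` cball 0 \<rho>)" by (rule compact_imp_closed)
  have closure_in: "q z \<in> p ` cball 0 \<rho>" if "norm z \<le> s" for z
  proof -
    \<comment> \<open>The inclusion passes from the open disc to its closure because the image of
      \<open>cball 0 \<rho>\<close> is compact, hence closed.\<close>
    have "q ` closure (ball 0 s) \<subseteq> p ` cball 0 \<rho>"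
    proof (rule image_closure_subset)
      show "continuous_on (closure (ball 0 s)) q"
        using continuous_on_subset[OF cq s1] \<open>s > 0\<close> by simp
      show "q ` ball 0 s \<subseteq> p ` cball 0 \<rho>" using inside by fastforce
    qed fact
    then show ?thesis using that \<open>s > 0\<close> by auto
  qed
  obtain g where g: "g holomorphic_on (p ` unit_disc)"
      "\<And>z. z \<in> unit_disc \<Longrightarrow> deriv p z * deriv g (p z) = 1"
      "\<And>z. z \<in> unit_disc \<Longrightarrow> g (p z) = z"
    using holomorphic_has_inverse[OF p(1) open_ball p(2)] by auto
  define w where "w = (\<lambda>z. g (q z))"
  define U where "U = unit_disc \<inter> q -` (p ` unit_disc)"
  have "open U"
    unfolding U_def by (intro continuous_open_preimage cq open_ball open_mapping_thm3 p)
  have holw: "w holomorphic_on U"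
    using holomorphic_on_compose_gen[OF holomorphic_on_subset[OF q] g(1), of U]
    by (auto simp: w_def o_def U_def)
  have qw: "q z = p (w z)" "norm (w z) \<le> \<rho>" if "norm z \<le> s" for z
    using closure_in[OF that] g(3) cbsub by (auto simp: w_def)
  have lt: "norm (w z) < \<rho>" if "norm z < s" for z
    using inside[OF that] g(3) bsub by (auto simp: w_def)
  have sU: "cball 0 s \<subseteq> U"
    using closure_in s1 cbsub by (fastforce simp: U_def)
  have w0: "w 0 = 0" using \<open>q 0 = p 0\<close> g(3)[of 0] by (simp add: w_def)
  have nw: "norm (w z0) = \<rho>"
    using qw[of z0] qz0 by (force simp: s_def)
  obtain m where m: "m \<ge> 1" "z0 * deriv w z0 = of_real m * w z0"
    using Jack_lemma[OF holw \<open>open U\<close> sU w0 \<rho>(1) lt qw(2) s_def[symmetric] nw] by blast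
  have wD: "w z0 \<in> unit_disc" using nw \<rho> by simp
  have z0U: "z0 \<in> U" using sU by (auto simp: s_def)
  have "deriv q z0 = deriv w z0 * deriv p (w z0)"
  proof -
    have "(p has_field_derivative deriv p (w z0)) (at (w z0))"
      by (rule holomorphic_derivI[OF p(1) open_ball wD])
    moreover have "(w has_field_derivative deriv w z0) (at z0)"
      by (rule holomorphic_derivI[OF holw \<open>open U\<close> z0U])
    ultimately have "((p \<circ> w) has_field_derivative deriv p (w z0) * deriv w z0) (at z0)"
      by (rule DERIV_chain)
    then have "(q has_field_derivative deriv p (w z0) * deriv w z0) (at z0)"
    proof (rule has_field_derivative_transform_within_open[OF _ \<open>open U\<close> z0U])
      fix z assume "z \<in> U"
      then obtain x where "x \<in> unit_disc" "q z = p x" by (auto simp: U_def)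
      then show "(p \<circ> w) z = q z" using g(3) by (simp add: w_def)
    qed
    then show ?thesis by (simp add: DERIV_imp_deriv mult.commute)
  qed
  then have "z0 * deriv q z0 = of_real m * (w z0 * deriv p (w z0))"
    using m(2) by (metis mult.assoc)
  moreover have "continuous_on (cball 0 s) w"
    using holomorphic_on_imp_continuous_on[OF holw] sU continuous_on_subset by blast
  ultimately show thesis
    using sa qw nw m w0 by (intro that[of z0 w m]) (auto simp: s_def)
qed

subsection \<open>The superordination\<close>

text \<open>Intended for an analytic logarithm \<open>L\<close> of \<open>p\<close>: replacing the
  principal power in \<open>sum_op\<close> by \<open>exp (k * L z)\<close> gives an expression that
  is analytic for every real \<open>k\<close>.\<close>

definition log_sum_op ::
    "real \<Rightarrow> complex \<Rightarrow> complex \<Rightarrow> complex \<Rightarrow> (complex \<Rightarrow> complex) \<Rightarrow> (complex \<Rightarrow> complex) \<Rightarrow> complex \<Rightarrow> complex" where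
  "log_sum_op k \<beta> \<gamma> \<delta> L p z = exp (of_real k * L z) * (p z + \<delta> + bb_term \<beta> \<gamma> p z)"

lemma bb_term_holomorphic:
  assumes "p holomorphic_on unit_disc" "\<And>z. z \<in> unit_disc \<Longrightarrow> \<beta> * p z + \<gamma> \<noteq> 0"
  shows "bb_term \<beta> \<gamma> p holomorphic_on unit_disc"
  unfolding bb_term_def using assms by (intro holomorphic_intros) auto

lemma class_R_D:
  assumes "p \<in> class_R \<alpha> \<beta> \<gamma> \<delta> \<mu>"
  shows "p holomorphic_on unit_disc" "p 0 = 1"
    "z \<in> unit_disc \<Longrightarrow> p z \<noteq> 0" "z \<in> unit_disc \<Longrightarrow> \<beta> * p z + \<gamma> \<noteq> 0"
    "(\<lambda>z. p z powr of_real \<alpha>) holomorphic_on unit_disc"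
    "(\<lambda>z. (p z + \<delta> + bb_term \<beta> \<gamma> p z) powr of_real \<mu>) holomorphic_on unit_disc"
    "(\<lambda>z. p z + \<delta> + bb_term \<beta> \<gamma> p z) holomorphic_on unit_disc"
  using assms unfolding class_R_def
  by (auto intro!: holomorphic_intros bb_term_holomorphic)

lemma class_R_log:
  assumes "p \<in> class_R \<alpha> \<beta> \<gamma> \<delta> \<mu>"
  obtains L where "L holomorphic_on unit_disc" "\<And>z. z \<in> unit_disc \<Longrightarrow> exp (L z) = p z" "L 0 = 0"
  using holomorphic_log_normalized[OF class_R_D(1,3)[OF assms]] class_R_D(2)[OF assms] by force

lemma sum_op_factor:
  assumes "p z \<noteq> 0"
  shows "sum_op \<alpha> \<beta> \<gamma> \<delta> \<mu> p z = p z powr of_real (\<alpha> / \<mu>) * (p z + \<delta> + bb_term \<beta> \<gamma> p z)"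
  using assms unfolding sum_op_def by (simp add: powr_add algebra_simps)

lemma sum_op_eq_log_sum_op:
  assumes p: "p \<in> class_R \<alpha> \<beta> \<gamma> \<delta> \<mu>"
    and L: "L holomorphic_on unit_disc" "\<And>z. z \<in> unit_disc \<Longrightarrow> exp (L z) = p z" "L 0 = 0"
    and hol: "(\<lambda>z. p z powr of_real (\<alpha> / \<mu>)) holomorphic_on unit_disc" and z: "z \<in> unit_disc"
  shows "sum_op \<alpha> \<beta> \<gamma> \<delta> \<mu> p z = log_sum_op (\<alpha> / \<mu>) \<beta> \<gamma> \<delta> L p z"
  using sum_op_factor[of p z, OF class_R_D(3)[OF p z]]
    holomorphic_powr_eq_exp_log[OF hol L(1,2) _ z] L(3) class_R_D(2)[OF p]
  unfolding log_sum_op_def by simp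

text \<open>For \<open>\<mu> < 1\<close> the second factor of \<open>sum_op\<close> is not
  identically zero, as \<open>sum_op\<close> is injective, so by
  \<open>holomorphic_powr_nonzero\<close> it never vanishes. The power of \<open>p\<close> is then a
  quotient of analytic functions. For \<open>\<mu> = 1\<close> its analyticity is part of
  \<open>class_R\<close>.\<close>

lemma univalent_sum_op_imp:
  assumes p: "p \<in> class_R \<alpha> \<beta> \<gamma> \<delta> \<mu>" and \<mu>: "0 < \<mu>" "\<mu> \<le> 1"
    and u: "univalent (sum_op \<alpha> \<beta> \<gamma> \<delta> \<mu> p)"
  shows "(\<lambda>z. p z powr of_real (\<alpha> / \<mu>)) holomorphic_on unit_disc"
    and "\<mu> < 1 \<Longrightarrow> z \<in> unit_disc \<Longrightarrow> p z + \<delta> + bb_term \<beta> \<gamma> p z \<noteq> 0"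
proof -
  let ?S = "\<lambda>z. p z + \<delta> + bb_term \<beta> \<gamma> p z"
  have nz: "?S z \<noteq> 0" if "\<mu> < 1" "z \<in> unit_disc" for z
  proof -
    have "\<exists>a\<in>unit_disc. ?S a \<noteq> 0"
    proof (rule ccontr)
      assume "\<not> (\<exists>a\<in>unit_disc. ?S a \<noteq> 0)"
      then have "sum_op \<alpha> \<beta> \<gamma> \<delta> \<mu> p a = 0" if "a \<in> unit_disc" for a
        using sum_op_factor[of p a, OF class_R_D(3)[OF p that]] that by auto
      then have "sum_op \<alpha> \<beta> \<gamma> \<delta> \<mu> p 0 = sum_op \<alpha> \<beta> \<gamma> \<delta> \<mu> p (1/2)" by simp
      moreover have "(0::complex) \<in> unit_disc" "(1/2::complex) \<in> unit_disc" by auto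
      ultimately have "(0::complex) = 1/2"
        using u unfolding univalent_def inj_on_def by blast
      then show False by simp
    qed
    then show ?thesis
      using holomorphic_powr_nonzero[OF class_R_D(6)[OF p]] \<mu> that by blast
  qed
  then show "\<mu> < 1 \<Longrightarrow> z \<in> unit_disc \<Longrightarrow> p z + \<delta> + bb_term \<beta> \<gamma> p z \<noteq> 0" by blast
  show "(\<lambda>z. p z powr of_real (\<alpha> / \<mu>)) holomorphic_on unit_disc"
  proof (cases "\<mu> = 1")
    case True
    then show ?thesis using class_R_D(5)[OF p] by simp
  next
    case False
    then have "\<mu> < 1" using \<mu> by simp
    have "(\<lambda>z. sum_op \<alpha> \<beta> \<gamma> \<delta> \<mu> p z / ?S z) holomorphic_on unit_disc"
      using u nz[OF \<open>\<mu> < 1\<close>] class_R_D(7)[OF p] unfolding univalent_def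
      by (intro holomorphic_on_divide) auto
    then show ?thesis
    proof (rule holomorphic_transform)
      fix z :: complex assume "z \<in> unit_disc"
      then show "sum_op \<alpha> \<beta> \<gamma> \<delta> \<mu> p z / ?S z = p z powr of_real (\<alpha> / \<mu>)"
        using sum_op_factor[of p z, OF class_R_D(3)[OF p]] nz[OF \<open>\<mu> < 1\<close>] by simp
    qed
  qed
qed

text \<open>
  Only logarithms that are analytic in the disc and agree at \<open>0\<close> allow the \<open>\<mu>\<close>-th root to be taken
  in the superordination: it need not be legitimate for the principal powers of \<open>q\<close>.
\<close>
lemma log_sum_op_subordination:
  assumes p: "p \<in> class_R \<alpha> \<beta> \<gamma> \<delta> \<mu>" and q: "q \<in> class_R \<alpha> \<beta> \<gamma> \<delta> \<mu>" and \<mu>: "0 < \<mu>" "\<mu> \<le> 1"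
    and u: "univalent (sum_op \<alpha> \<beta> \<gamma> \<delta> \<mu> p)"
    and Lp: "Lp holomorphic_on unit_disc" "\<And>z. z \<in> unit_disc \<Longrightarrow> exp (Lp z) = p z" "Lp 0 = 0"
    and Lq: "Lq holomorphic_on unit_disc" "\<And>z. z \<in> unit_disc \<Longrightarrow> exp (Lq z) = q z" "Lq 0 = 0"
    and w: "w holomorphic_on unit_disc" "w ` unit_disc \<subseteq> unit_disc" "w 0 = 0"
    and eq: "\<And>z. z \<in> unit_disc \<Longrightarrow> power_op \<alpha> \<beta> \<gamma> \<delta> \<mu> q z = power_op \<alpha> \<beta> \<gamma> \<delta> \<mu> p (w z)"
    and z: "z \<in> unit_disc"
  shows "log_sum_op (\<alpha> / \<mu>) \<beta> \<gamma> \<delta> Lq q z = log_sum_op (\<alpha> / \<mu>) \<beta> \<gamma> \<delta> Lp p (w z)"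
proof -
  let ?S = "\<lambda>p z. p z + \<delta> + bb_term \<beta> \<gamma> p z"
  have wz: "w x \<in> unit_disc" if "x \<in> unit_disc" for x using w(2) that by blast
  have pa: "p x powr of_real \<alpha> = exp (of_real \<alpha> * Lp x)"
    and qa: "q x powr of_real \<alpha> = exp (of_real \<alpha> * Lq x)" if "x \<in> unit_disc" for x
    using holomorphic_powr_eq_exp_log[OF class_R_D(5)[OF p] Lp(1,2) _ that] Lp(3) class_R_D(2)[OF p]
      holomorphic_powr_eq_exp_log[OF class_R_D(5)[OF q] Lq(1,2) _ that] Lq(3) class_R_D(2)[OF q]
    by auto
  show ?thesis
  proof (cases "\<mu> = 1")
    case True
    have one: "x powr of_real 1 = x" for x :: complex by (simp add: powr_def)
    show ?thesis
      using eq[OF z] pa[OF wz[OF z]] qa[OF z]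
      unfolding power_op_def log_sum_op_def True one by simp
  next
    case False
    then have m1: "\<mu> < 1" using \<mu> by simp
    note pnz = univalent_sum_op_imp(2)[OF p \<mu> u m1]
    \<comment> \<open>Both functions are 1 at the origin and \<open>bb_term\<close> vanishes there.
      Thus nonvanishing passes from \<open>p\<close> to \<open>q\<close> at one point, and from
      there to the whole disc by \<open>holomorphic_powr_nonzero\<close>.\<close>
    have S0: "?S q 0 = ?S p 0"
      using class_R_D(2)[OF p] class_R_D(2)[OF q] by (simp add: bb_term_def)
    have "(0::complex) \<in> unit_disc" by simp
    then have "?S q 0 \<noteq> 0" using pnz[of 0] S0 by metis
    then have qnz: "?S q x \<noteq> 0" if "x \<in> unit_disc" for x
      using holomorphic_powr_nonzero[OF class_R_D(6)[OF q] \<mu>(1) m1 \<open>0 \<in> unit_disc\<close> _ that] by blast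
    obtain gp where gp: "gp holomorphic_on unit_disc" "\<And>z. z \<in> unit_disc \<Longrightarrow> exp (gp z) = ?S p z"
        "gp 0 = Ln (?S p 0)"
      using holomorphic_log_normalized[OF class_R_D(7)[OF p] pnz] by blast
    obtain gq where gq: "gq holomorphic_on unit_disc" "\<And>z. z \<in> unit_disc \<Longrightarrow> exp (gq z) = ?S q z"
        "gq 0 = Ln (?S q 0)"
      using holomorphic_log_normalized[OF class_R_D(7)[OF q] qnz] by blast
    define Gp where "Gp x = of_real (\<alpha> / \<mu>) * Lp x + gp x" for x
    define Gq where "Gq x = of_real (\<alpha> / \<mu>) * Lq x + gq x" for x
    have am: "of_real \<alpha> = (of_real \<mu> * of_real (\<alpha> / \<mu>) :: complex)"
      using \<mu> by (simp add: field_simps)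
    have Pp: "power_op \<alpha> \<beta> \<gamma> \<delta> \<mu> p x = exp (of_real \<mu> * Gp x)" if "x \<in> unit_disc" for x
      using pa[OF that] holomorphic_powr_eq_exp_log[OF class_R_D(6)[OF p] gp that]
      unfolding power_op_def Gp_def by (simp only: am distrib_left exp_add mult.assoc)
    have Pq: "power_op \<alpha> \<beta> \<gamma> \<delta> \<mu> q x = exp (of_real \<mu> * Gq x)" if "x \<in> unit_disc" for x
      using qa[OF that] holomorphic_powr_eq_exp_log[OF class_R_D(6)[OF q] gq that]
      unfolding power_op_def Gq_def by (simp only: am distrib_left exp_add mult.assoc)
    have hG: "Gp holomorphic_on unit_disc" "Gq holomorphic_on unit_disc"
      unfolding Gp_def[abs_def] Gq_def[abs_def] by (intro holomorphic_intros Lp Lq gp gq)+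
    \<comment> \<open>The superordination equates the exponentials of \<mu> times these functions.
      They agree at 0, so the factor \<mu> can be cancelled in the exponent.\<close>
    have "Gq z = Gp (w z)"
    proof (rule exp_eq_imp_eq[where f = Gq and g = "\<lambda>z. Gp (w z)" and S = unit_disc and a = "of_real \<mu>" and ?x0.0 = 0])
      show "continuous_on unit_disc (\<lambda>z. Gp (w z))"
        using holomorphic_on_compose_gen[OF w(1) hG(1) w(2)]
        by (simp add: o_def holomorphic_on_imp_continuous_on)
      show "Gq 0 = Gp (w 0)"
        using gp(3) gq(3) S0 w(3) Lp(3) Lq(3) by (simp add: Gp_def Gq_def)
      show "exp (of_real \<mu> * Gq x) = exp (of_real \<mu> * Gp (w x))" if "x \<in> unit_disc" for x
        using eq[OF that] Pp[OF wz[OF that]] Pq[OF that] by simp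
    qed (use hG \<mu> z in \<open>auto intro: holomorphic_on_imp_continuous_on\<close>)
    then have "exp (Gq z) = exp (Gp (w z))" by simp
    then show ?thesis
      using gp(2)[OF wz[OF z]] gq(2)[OF z]
      by (simp add: Gp_def Gq_def log_sum_op_def exp_add)
  qed
qed

section \<open>The Loewner chain generated by q\<close>

lemma deriv_log:
  assumes "L holomorphic_on unit_disc" "\<And>z. z \<in> unit_disc \<Longrightarrow> exp (L z) = q z"
    and z: "z \<in> unit_disc"
  shows "(L has_field_derivative deriv q z / q z) (at z)"
proof -
  have L: "(L has_field_derivative deriv L z) (at z)"
    using assms by (intro holomorphic_derivI[OF assms(1) open_ball])
  then have "((\<lambda>z. exp (L z)) has_field_derivative exp (L z) * deriv L z) (at z)"
    by (auto intro!: derivative_eq_intros)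
  then have "(q has_field_derivative exp (L z) * deriv L z) (at z)"
    by (rule has_field_derivative_transform_within_open[OF _ open_ball z]) (use assms in auto)
  then have "deriv q z = q z * deriv L z" using assms(2)[OF z] DERIV_imp_deriv by metis
  moreover have "q z \<noteq> 0" using assms(2)[OF z] by (metis exp_not_eq_zero)
  ultimately show ?thesis using L by simp
qed

text \<open>With k = \<alpha> / \<mu>, logarithmic differentiation of z V = q^k R gives 1 + z V' / V
  = k z q' / q + z R' / R, and direct differentiation gives T' / V = (\<beta> q + \<gamma>) (1 + k +
  k \<delta> / q). So the two real-part hypotheses are the two positivity conditions of the locale;
  at \<open>z = 0\<close> the first expression is 1.\<close>

lemma starlike_chain_log_sum_op:
  assumes q: "q \<in> class_R \<alpha> \<beta> \<gamma> \<delta> \<mu>" "univalent q"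
    and L: "L holomorphic_on unit_disc" "\<And>z. z \<in> unit_disc \<Longrightarrow> exp (L z) = q z"
    and tr: "\<And>z. z \<in> unit_disc \<Longrightarrow>
           Re ((\<beta> * q z + \<gamma>) * (1 + of_real (\<alpha> / \<mu>) + of_real \<alpha> * \<delta> / (of_real \<mu> * q z))) > 0"
    and st: "\<And>z. z \<in> unit_disc \<Longrightarrow>
           Re (of_real (\<alpha> / \<mu>) * (z * deriv q z / q z) + zlogderiv (bb_term \<beta> \<gamma> q) z) > 0"
  shows "starlike_chain (\<lambda>z. exp (of_real (\<alpha> / \<mu>) * L z) * (deriv q z / (\<beta> * q z + \<gamma>)))
           (\<lambda>z. exp (of_real (\<alpha> / \<mu>) * L z) * (q z + \<delta>))"
    (is "starlike_chain ?V ?T")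
proof -
  let ?k = "of_real (\<alpha> / \<mu>) :: complex"
  let ?R = "bb_term \<beta> \<gamma> q"
  note qD = class_R_D[OF q(1)]
  have dqnz: "deriv q z \<noteq> 0" if "z \<in> unit_disc" for z
    using q(2) that unfolding univalent_def by (intro holomorphic_injective_imp_regular) auto
  have Vh: "?V holomorphic_on unit_disc"
    using qD by (intro holomorphic_intros L) auto
  have Th: "?T holomorphic_on unit_disc"
    by (intro holomorphic_intros L qD)
  have Vnz: "?V z \<noteq> 0" if "z \<in> unit_disc" for z
    using qD(4) dqnz that by simp
  have Rh: "?R holomorphic_on unit_disc" using qD(1,4) by (rule bb_term_holomorphic)
  have dE: "((\<lambda>z. exp (c * L z)) has_field_derivative exp (c * L z) * (c * (deriv q z / q z))) (at z)"
    if "z \<in> unit_disc" for c z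
    using DERIV_cmult[OF deriv_log[OF L that], of c] DERIV_exp DERIV_chain2 by blast
  show ?thesis
  proof (unfold_locales; (rule Vh Th Vnz)?)
    fix z :: complex assume z: "z \<in> unit_disc"
    show "0 < Re (1 + z * deriv ?V z / ?V z)"
    proof (cases "z = 0")
      case False
      have Rz: "?R z \<noteq> 0" using False dqnz[OF z] qD(4)[OF z] by (simp add: bb_term_def)
      \<comment> \<open>Away from the origin \<open>R\<close> has no zero, so the quotient is
        analytic at \<open>z\<close> and \<open>remove_sings\<close> leaves its value
        unchanged.\<close>
      have "zlogderiv ?R z = z * deriv ?R z / ?R z"
      proof -
        let ?U = "unit_disc \<inter> ?R -` (- {0})"
        have "open ?U"
          using holomorphic_on_imp_continuous_on[OF Rh] by (intro continuous_open_preimage) auto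
        moreover have "(\<lambda>z. z * deriv ?R z / ?R z) holomorphic_on ?U"
          by (intro holomorphic_intros holomorphic_on_subset[OF Rh]
              holomorphic_on_subset[OF holomorphic_deriv[OF Rh open_ball]]) auto
        ultimately have "(\<lambda>z. z * deriv ?R z / ?R z) analytic_on {z}"
          using z Rz analytic_on_open analytic_on_subset by (metis (no_types, lifting) Compl_iff IntI empty_subsetI insert_subset singletonD vimage_eq)
        then show ?thesis unfolding zlogderiv_def by (rule remove_sings_at_analytic)
      qed
      moreover have "1 + z * deriv ?V z / ?V z = ?k * (z * deriv q z / q z) + z * deriv ?R z / ?R z"
      proof -
        let ?E = "exp (?k * L z)"
        have "(?V has_field_derivative deriv ?V z) (at z)" by (rule holomorphic_derivI[OF Vh open_ball z])
        then have 1: "((\<lambda>z. z * ?V z) has_field_derivative ?V z + z * deriv ?V z) (at z)"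
          by (rule DERIV_mult'[THEN DERIV_cong, OF DERIV_ident]) simp
        have "(?R has_field_derivative deriv ?R z) (at z)" by (rule holomorphic_derivI[OF Rh open_ball z])
        from DERIV_mult'[OF dE[OF z] this]
        have 2: "((\<lambda>z. exp (?k * L z) * ?R z) has_field_derivative
            ?E * deriv ?R z + ?E * (?k * (deriv q z / q z)) * ?R z) (at z)" .
        have zV: "(\<lambda>z. z * ?V z) = (\<lambda>z. exp (?k * L z) * ?R z)" by (auto simp: bb_term_def)
        have 3: "?V z + z * deriv ?V z = ?E * deriv ?R z + ?E * (?k * (deriv q z / q z)) * ?R z"
          using DERIV_unique[OF 1[unfolded zV] 2] .
        have zV': "z * ?V z = ?E * ?R z" using zV by meson
        have "1 + z * deriv ?V z / ?V z = z * (?V z + z * deriv ?V z) / (z * ?V z)"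
          using Vnz[OF z] False by (simp only: distrib_left add_divide_distrib) simp
        also have "\<dots> = z * (?E * deriv ?R z + ?E * (?k * (deriv q z / q z)) * ?R z) / (?E * ?R z)"
          unfolding 3 zV' ..
        also have "\<dots> = ?k * (z * deriv q z / q z) + z * deriv ?R z / ?R z"
          using Rz by (simp add: distrib_left add_divide_distrib)
        finally show ?thesis .
      qed
      ultimately show ?thesis using st[OF z] by simp
    qed simp
    have "(?T has_field_derivative exp (?k * L z) * deriv q z
        + exp (?k * L z) * (?k * (deriv q z / q z)) * (q z + \<delta>)) (at z)"
      by (rule DERIV_mult'[OF dE[OF z], THEN DERIV_cong])
        (use holomorphic_derivI[OF qD(1) open_ball z] in \<open>auto intro!: derivative_eq_intros\<close>)
    then have "deriv ?T z = exp (?k * L z) * deriv q z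
        + exp (?k * L z) * (?k * (deriv q z / q z)) * (q z + \<delta>)"
      by (rule DERIV_imp_deriv)
    also have "\<dots> = ?V z * ((\<beta> * q z + \<gamma>) * (1 + ?k + of_real \<alpha> * \<delta> / (of_real \<mu> * q z)))"
    proof -
      have 1: "?V z * (\<beta> * q z + \<gamma>) = exp (?k * L z) * deriv q z" using qD(4)[OF z] by simp
      have 2: "of_real \<alpha> * \<delta> / (of_real \<mu> * q z) = ?k * (\<delta> / q z)" by simp
      have 3: "e * d + e * (c * (d / x)) * (x + \<delta>) = e * d * (1 + c + c * (\<delta> / x))"
        if "x \<noteq> 0" for e d c x :: complex
        using that by (simp add: field_simps)
      show ?thesis
        unfolding 2 3[OF qD(3)[OF z]] by (simp only: 1[symmetric] mult.assoc)
    qed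
    finally have "deriv ?T z / ?V z
        = (\<beta> * q z + \<gamma>) * (1 + ?k + of_real \<alpha> * \<delta> / (of_real \<mu> * q z))"
      by (simp only: nonzero_mult_div_cancel_left[OF Vnz[OF z]])
    then show "0 < Re (deriv ?T z / ?V z)"
      using tr[OF z] by (simp only:)
  qed
qed

section \<open>Comparison of the images of q and p\<close>

lemma subordinate_of_image_subset:
  assumes "q holomorphic_on unit_disc" "p holomorphic_on unit_disc" "inj_on p unit_disc"
    and "q 0 = p 0" "q ` unit_disc \<subseteq> p ` unit_disc"
  shows "q \<prec>\<^sub>s p"
proof -
  obtain g where g: "g holomorphic_on (p ` unit_disc)"
      "\<And>z. z \<in> unit_disc \<Longrightarrow> deriv p z * deriv g (p z) = 1"
      "\<And>z. z \<in> unit_disc \<Longrightarrow> g (p z) = z"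
    using holomorphic_has_inverse[OF assms(2) open_ball assms(3)] by auto
  have gq: "g (q z) \<in> unit_disc \<and> q z = p (g (q z))" if "z \<in> unit_disc" for z
  proof -
    have "q z \<in> p ` unit_disc" by (rule subsetD[OF assms(5) imageI[OF that]])
    then obtain x where x: "q z = p x" "x \<in> unit_disc" by (rule imageE)
    show ?thesis unfolding x(1) g(3)[OF x(2)] by (intro conjI x(2) refl)
  qed
  have "g (q 0) = 0" using assms(4) g(3)[of 0] by simp
  have "(g \<circ> q) holomorphic_on unit_disc"
    by (rule holomorphic_on_compose_gen[OF assms(1) g(1) assms(5)])
  then show ?thesis
    using assms(1,2) gq \<open>g (q 0) = 0\<close> unfolding subordinate_def
    by (intro conjI exI[of _ "g \<circ> q"]) (auto simp del: mem_ball)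
qed

text \<open>
  Comparing a slightly smaller disc in the domain of \<open>q\<close> with a slightly smaller disc in the
  domain of \<open>p\<close> makes any boundary regularity of \<open>p\<close> unnecessary.
\<close>
lemma image_subset_of_log_sum_op:
  assumes p: "p \<in> class_R \<alpha> \<beta> \<gamma> \<delta> \<mu>" "univalent p" and q: "q \<in> class_R \<alpha> \<beta> \<gamma> \<delta> \<mu>"
    and Lp: "Lp holomorphic_on unit_disc" "\<And>z. z \<in> unit_disc \<Longrightarrow> exp (Lp z) = p z" "Lp 0 = 0"
    and Lq: "Lq holomorphic_on unit_disc" "\<And>z. z \<in> unit_disc \<Longrightarrow> exp (Lq z) = q z" "Lq 0 = 0"
    and chain: "starlike_chain (\<lambda>z. exp (of_real k * Lq z) * (deriv q z / (\<beta> * q z + \<gamma>)))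
           (\<lambda>z. exp (of_real k * Lq z) * (q z + \<delta>))"
    and inj: "inj_on (log_sum_op k \<beta> \<gamma> \<delta> Lp p) unit_disc"
    and sub: "log_sum_op k \<beta> \<gamma> \<delta> Lq q ` unit_disc \<subseteq> log_sum_op k \<beta> \<gamma> \<delta> Lp p ` unit_disc"
  shows "q ` unit_disc \<subseteq> p ` unit_disc"
proof (rule ccontr)
  let ?P = "log_sum_op k \<beta> \<gamma> \<delta> Lp p" and ?h = "log_sum_op k \<beta> \<gamma> \<delta> Lq q"
  assume "\<not> q ` unit_disc \<subseteq> p ` unit_disc"
  then obtain a where a: "a \<in> unit_disc" "q a \<notin> p ` unit_disc" by blast
  note pD = class_R_D[OF p(1)] and qD = class_R_D[OF q]
  have Ph: "?P holomorphic_on unit_disc" and hh: "?h holomorphic_on unit_disc"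
    unfolding log_sum_op_def[abs_def] by (intro holomorphic_intros Lp Lq pD qD)+
  have asub: "cball 0 (norm a) \<subseteq> unit_disc" using a by auto
  obtain g where g: "g holomorphic_on (?P ` unit_disc)"
      "\<And>z. z \<in> unit_disc \<Longrightarrow> deriv ?P z * deriv g (?P z) = 1"
      "\<And>z. z \<in> unit_disc \<Longrightarrow> g (?P z) = z"
    using holomorphic_has_inverse[OF Ph open_ball inj] by auto
  have "(g \<circ> ?h) holomorphic_on unit_disc"
    by (rule holomorphic_on_compose_gen[OF hh g(1) sub])
  then have "continuous_on (cball 0 (norm a)) (\<lambda>z. norm (g (?h z)))"
    using asub holomorphic_on_imp_continuous_on holomorphic_on_subset
    by (intro continuous_on_norm) (fastforce simp: o_def)
  then obtain y where y: "y \<in> cball 0 (norm a)" "\<And>x. x \<in> cball 0 (norm a) \<Longrightarrow> norm (g (?h x)) \<le> norm (g (?h y))"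
    using continuous_attains_sup[of "cball 0 (norm a)"] by (metis compact_cball centre_in_cball empty_iff norm_ge_zero)
  have hg: "g (?h x) \<in> unit_disc" if x: "x \<in> unit_disc" for x
  proof -
    have "?h x \<in> ?P ` unit_disc" by (rule subsetD[OF sub imageI[OF x]])
    then obtain v where v: "?h x = ?P v" "v \<in> unit_disc" by (rule imageE)
    show ?thesis unfolding v(1) g(3)[OF v(2)] by (rule v(2))
  qed
  \<comment> \<open>The point \<open>y\<close> maximizes the modulus of \<open>g (?h x)\<close> on
    the closed disc of radius |a|. The midpoint between this maximum and 1 exceeds the maximum and
    is positive even if the maximum is 0.\<close>
  define \<rho> where "\<rho> = (norm (g (?h y)) + 1) / 2"
  have ny: "norm (g (?h y)) < 1" using hg[of y] y(1) asub by auto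
  have \<rho>: "0 < \<rho>" "\<rho> < 1" "norm (g (?h y)) < \<rho>"
    using ny norm_ge_zero[of "g (?h y)"] by (auto simp: \<rho>_def simp del: norm_ge_zero intro: add_nonneg_pos)
  have qa: "q a \<notin> p ` ball 0 \<rho>" using a(2) \<rho>(2) by auto
  obtain w z0 m where w: "norm z0 \<le> norm a" "continuous_on (cball 0 (norm z0)) w"
    "w ` cball 0 (norm z0) \<subseteq> cball 0 \<rho>" "w 0 = 0" "\<And>z. z \<in> cball 0 (norm z0) \<Longrightarrow> q z = p (w z)"
    "norm (w z0) = \<rho>" "m \<ge> (1::real)" "z0 * deriv q z0 = of_real m * (w z0 * deriv p (w z0))"
    using first_exit_point[OF pD(1) _ qD(1) _ \<rho>(1,2) a(1) qa] p(2) pD(2) qD(2)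
    unfolding univalent_def by metis
  have z0sub: "cball 0 (norm z0) \<subseteq> unit_disc" and wsub: "w ` cball 0 (norm z0) \<subseteq> unit_disc"
    using w(1,3) a(1) \<rho>(2) by force+
  have wz0: "w z0 \<in> unit_disc" using w(6) \<rho>(2) by simp
  \<comment> \<open>Both sides continue the same logarithm from the origin over the disc of radius
    |z0|, so the factors \<open>exp (k * L)\<close> of \<open>p\<close> and \<open>q\<close>
    coincide at the exit point.\<close>
  have Lqp: "Lq z0 = Lp (w z0)"
  proof (rule exp_eq_imp_eq[where f = Lq and g = "\<lambda>z. Lp (w z)" and S = "cball 0 (norm z0)" and a = 1 and ?x0.0 = 0])
    show "continuous_on (cball 0 (norm z0)) Lq"
      using Lq(1) z0sub continuous_on_subset holomorphic_on_imp_continuous_on by blast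
    show "continuous_on (cball 0 (norm z0)) (\<lambda>z. Lp (w z))"
      by (rule continuous_on_compose2[OF holomorphic_on_imp_continuous_on[OF Lp(1)] w(2) wsub])
    show "exp (1 * Lq x) = exp (1 * Lp (w x))" if "x \<in> cball 0 (norm z0)" for x
    proof -
      have "x \<in> unit_disc" "w x \<in> unit_disc" using that z0sub wsub by blast+
      then show ?thesis using Lp(2) Lq(2) w(5)[OF that] by simp
    qed
  qed (use w(4) Lp(3) Lq(3) in auto)
  have qz0: "q z0 = p (w z0)" using w(5)[of z0] by simp
  \<comment> \<open>The multiplier \<open>m\<close> of Jack's lemma turns into a divisor: this is
    the chain member with t = 1 / m at \<open>z0\<close>.\<close>
  have "?P (w z0) = exp (of_real k * Lq z0) * (q z0 + \<delta>)
      + z0 * (exp (of_real k * Lq z0) * (deriv q z0 / (\<beta> * q z0 + \<gamma>))) / of_real m"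
  proof -
    have "w z0 * deriv p (w z0) = z0 * deriv q z0 / of_real m"
      using w(7,8) by simp
    then have "bb_term \<beta> \<gamma> p (w z0) = z0 * deriv q z0 / of_real m / (\<beta> * q z0 + \<gamma>)"
      by (simp add: bb_term_def qz0)
    then show ?thesis
      by (simp add: log_sum_op_def Lqp qz0 algebra_simps)
  qed
  moreover obtain z where z: "z \<in> cball 0 (norm z0)" and
    "exp (of_real k * Lq z) * (q z + \<delta>) + z * (exp (of_real k * Lq z) * (deriv q z / (\<beta> * q z + \<gamma>)))
     = exp (of_real k * Lq z0) * (q z0 + \<delta>)
      + z0 * (exp (of_real k * Lq z0) * (deriv q z0 / (\<beta> * q z0 + \<gamma>))) / of_real m"
  proof -
    have "norm z0 < 1" using w(1) a(1) by simp
    from starlike_chain.chain_subset[OF chain order_refl this w(7)] show thesis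
      using that by (rule bexE)
  qed
  moreover have "exp (of_real k * Lq z) * (q z + \<delta>) + z * (exp (of_real k * Lq z) * (deriv q z / (\<beta> * q z + \<gamma>)))
     = ?h z"
    by (simp add: log_sum_op_def bb_term_def algebra_simps)
  ultimately have "?P (w z0) = ?h z" by simp
  moreover have "z \<in> unit_disc" using z z0sub by blast
  \<comment> \<open>Since \<open>z\<close> has modulus at most |a|, this forces the modulus of
    \<open>w z0\<close> below \<open>\<rho>\<close>, although it equals
    \<open>\<rho>\<close>.\<close>
  ultimately have "w z0 = g (?h z)" using g(3)[OF wz0] by simp
  moreover have "norm (g (?h z)) \<le> norm (g (?h y))" using y(2)[of z] z w(1) by simp
  ultimately show False using w(6) \<rho>(3) by simp
qed

theorem theorem2p4:
  fixes \<alpha> \<mu> :: real and \<beta> \<gamma> \<delta> :: complex and p q :: "complex \<Rightarrow> complex"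
  assumes "0 < \<mu>" and "\<mu> \<le> 1" and "\<alpha> + \<mu> \<ge> 0" and "\<beta> \<noteq> 0"
    and "q \<in> class_R \<alpha> \<beta> \<gamma> \<delta> \<mu>" and "univalent q"
    and "\<And>z. z \<in> unit_disc \<Longrightarrow>
           Re ((\<beta> * q z + \<gamma>) * (1 + of_real (\<alpha> / \<mu>) + of_real \<alpha> * \<delta> / (of_real \<mu> * q z))) > 0"
    and "\<And>z. z \<in> unit_disc \<Longrightarrow>
           Re (of_real (\<alpha> / \<mu>) * (z * deriv q z / q z) + zlogderiv (bb_term \<beta> \<gamma> q) z) > 0"
    and "p \<in> class_R \<alpha> \<beta> \<gamma> \<delta> \<mu>"
    and "p holomorphic_on unit_disc" and "p \<in> class_Q"
    and "univalent (sum_op \<alpha> \<beta> \<gamma> \<delta> \<mu> p)"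
    and "power_op \<alpha> \<beta> \<gamma> \<delta> \<mu> q \<prec>\<^sub>s power_op \<alpha> \<beta> \<gamma> \<delta> \<mu> p"
  shows "q \<prec>\<^sub>s p \<and> best_subordinant \<alpha> \<beta> \<gamma> \<delta> \<mu> (power_op \<alpha> \<beta> \<gamma> \<delta> \<mu> q) q"
proof -
  note \<mu> = assms(1,2) and q = assms(5)
  let ?h = "power_op \<alpha> \<beta> \<gamma> \<delta> \<mu> q"
  obtain Lq where Lq: "Lq holomorphic_on unit_disc" "\<And>z. z \<in> unit_disc \<Longrightarrow> exp (Lq z) = q z" "Lq 0 = 0"
    using class_R_log[OF q] by blast
  have chain: "starlike_chain (\<lambda>z. exp (of_real (\<alpha> / \<mu>) * Lq z) * (deriv q z / (\<beta> * q z + \<gamma>)))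
           (\<lambda>z. exp (of_real (\<alpha> / \<mu>) * Lq z) * (q z + \<delta>))"
    by (rule starlike_chain_log_sum_op[OF q assms(6) Lq(1,2) assms(7,8)])
  \<comment> \<open>Proved for an arbitrary solution: this yields both the subordination to
    \<open>p\<close> and the fact that \<open>q\<close> is a subordinant.\<close>
  have main: "q \<prec>\<^sub>s f" if f: "superord_solution \<alpha> \<beta> \<gamma> \<delta> \<mu> ?h f" for f
  proof -
    have fR: "f \<in> class_R \<alpha> \<beta> \<gamma> \<delta> \<mu>" and fu: "univalent f" "univalent (sum_op \<alpha> \<beta> \<gamma> \<delta> \<mu> f)"
      and fh: "?h \<prec>\<^sub>s power_op \<alpha> \<beta> \<gamma> \<delta> \<mu> f"
      using f unfolding superord_solution_def by auto
    obtain w where w: "w holomorphic_on unit_disc" "w ` unit_disc \<subseteq> unit_disc" "w 0 = 0"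
        "\<And>z. z \<in> unit_disc \<Longrightarrow> ?h z = power_op \<alpha> \<beta> \<gamma> \<delta> \<mu> f (w z)"
      using fh unfolding subordinate_def by blast
    obtain Lf where Lf: "Lf holomorphic_on unit_disc" "\<And>z. z \<in> unit_disc \<Longrightarrow> exp (Lf z) = f z" "Lf 0 = 0"
      using class_R_log[OF fR] by blast
    have "inj_on (log_sum_op (\<alpha> / \<mu>) \<beta> \<gamma> \<delta> Lf f) unit_disc"
      using fu(2) sum_op_eq_log_sum_op[OF fR Lf univalent_sum_op_imp(1)[OF fR \<mu> fu(2)]]
      unfolding univalent_def by (metis (no_types, lifting) inj_on_cong)
    moreover have "log_sum_op (\<alpha> / \<mu>) \<beta> \<gamma> \<delta> Lq q ` unit_disc \<subseteq> log_sum_op (\<alpha> / \<mu>) \<beta> \<gamma> \<delta> Lf f ` unit_disc"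
      using log_sum_op_subordination[OF fR q \<mu> fu(2) Lf Lq w] w(2) by blast
    ultimately have "q ` unit_disc \<subseteq> f ` unit_disc"
      using image_subset_of_log_sum_op[OF fR fu(1) q Lf Lq chain] by blast
    then show ?thesis
      using fu(1) class_R_D(1,2)[OF fR] class_R_D(1,2)[OF q] unfolding univalent_def
      by (intro subordinate_of_image_subset) auto
  qed
  have pu: "univalent p"
  proof -
    \<comment> \<open>Exceptional points lie on the unit circle, so membership in
      \<open>class_Q\<close> gives injectivity on the open disc.\<close>
    have "unit_disc \<subseteq> cball 0 1 - exceptional_set p" by (auto simp: exceptional_set_def)
    then show ?thesis
      using assms(10,11) unfolding univalent_def class_Q_def by (auto intro: inj_on_subset)
  qed
  have "superord_solution \<alpha> \<beta> \<gamma> \<delta> \<mu> ?h p"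
    unfolding superord_solution_def using pu assms(9,12,13) by blast
  then have qp: "q \<prec>\<^sub>s p" by (rule main)
  have hh: "?h holomorphic_on unit_disc"
    unfolding power_op_def[abs_def] by (intro holomorphic_intros class_R_D[OF q])
  \<comment> \<open>Once \<open>q\<close> is itself a solution, every subordinant is subordinate to
    \<open>q\<close>, which makes \<open>q\<close> the best one. The univalence of its
    \<open>sum_op\<close> comes from \<open>chain_inj\<close>.\<close>
  have "superord_solution \<alpha> \<beta> \<gamma> \<delta> \<mu> ?h q"
  proof -
    have "?h \<prec>\<^sub>s ?h"
      unfolding subordinate_def using hh by (auto intro!: exI[of _ "\<lambda>z. z"])
    moreover have "univalent (sum_op \<alpha> \<beta> \<gamma> \<delta> \<mu> q)"
    proof -
      obtain w where w: "w holomorphic_on unit_disc" "w ` unit_disc \<subseteq> unit_disc"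
          "\<And>z. z \<in> unit_disc \<Longrightarrow> q z = p (w z)"
        using qp unfolding subordinate_def by blast
      \<comment> \<open>Analyticity of this principal power is inherited from that of
        \<open>p\<close> through \<open>q z = p (w z)\<close>.\<close>
      have qk: "(\<lambda>z. q z powr of_real (\<alpha> / \<mu>)) holomorphic_on unit_disc"
        using holomorphic_on_compose_gen[OF w(1) univalent_sum_op_imp(1)[OF assms(9) \<mu> assms(12)] w(2)]
        by (rule holomorphic_transform) (simp add: w(3))
      have eq: "sum_op \<alpha> \<beta> \<gamma> \<delta> \<mu> q z = log_sum_op (\<alpha> / \<mu>) \<beta> \<gamma> \<delta> Lq q z"
        if "z \<in> unit_disc" for z
        by (rule sum_op_eq_log_sum_op[OF q Lq(1) _ Lq(3) qk that]) (rule Lq(2))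
      have "inj_on (sum_op \<alpha> \<beta> \<gamma> \<delta> \<mu> q) unit_disc"
      proof -
        have chain_eq: "sum_op \<alpha> \<beta> \<gamma> \<delta> \<mu> q z = exp (of_real (\<alpha> / \<mu>) * Lq z) * (q z + \<delta>)
            + z * (exp (of_real (\<alpha> / \<mu>) * Lq z) * (deriv q z / (\<beta> * q z + \<gamma>)))"
          if "z \<in> unit_disc" for z
          unfolding eq[OF that] log_sum_op_def bb_term_def by (simp add: algebra_simps)
        show ?thesis
          by (rule inj_on_cong[THEN iffD2, OF _ starlike_chain.chain_inj[OF chain]]) (rule chain_eq)
      qed
      moreover have "sum_op \<alpha> \<beta> \<gamma> \<delta> \<mu> q holomorphic_on unit_disc"
      proof (rule holomorphic_transform)
        show "log_sum_op (\<alpha> / \<mu>) \<beta> \<gamma> \<delta> Lq q holomorphic_on unit_disc"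
          unfolding log_sum_op_def[abs_def] by (intro holomorphic_intros Lq class_R_D[OF q])
      qed (simp add: eq)
      ultimately show ?thesis by (simp add: univalent_def)
    qed
    ultimately show ?thesis
      unfolding superord_solution_def using q assms(6) by blast
  qed
  then have "best_subordinant \<alpha> \<beta> \<gamma> \<delta> \<mu> ?h q"
    unfolding best_subordinant_def subordinant_def
    using main assms(6) class_R_D(1)[OF q] by blast
  with qp show ?thesis by blast
qed

end
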